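(* Let $G = \Theta(l_1,\ldots,l_k)$ where $k \geq 2$, $l_1,\ldots,l_k \in \mathbb{N}$, $l_2 \leq \cdots \leq l_k$, and $l_2 \geq \max\{l_1,2\}$. (i) If there is a $j \in \{2,\ldots,k\}$ such that $l_1$ and $l_j$ have the same parity, then there is an $N \in \mathbb{N}$ such that $P_{DP}(G,m) < P(G,m)$ for all $m \geq N$. (ii) If $l_1$ and $l_j$ have different parity for each $j \in \{2,\ldots,k\}$, then there is an $N \in \mathbb{N}$ such that $P_{DP}(G,m) = P(G,m)$ for all $m \geq N$.
   Context: All graphs are finite and simple. For $l_1,\ldots,l_k \in \mathbb{N}$, the Generalized Theta graph $\Theta(l_1,\ldots,l_k)$ consists of two end vertices joined by $k$ internally disjoint paths of lengths $l_1,\ldots,l_k$. $P(G,m)$ denotes the chromatic polynomial of $G$. A cover of a graph $G$ is a pair $\mathcal{H}=(L,H)$ where $H$ is a graph and $L: V(G) \to \mathcal{P}(V(H))$ satisfies: (1) $\{L(u): u \in V(G)\}$ is a partition of $V(H)$; (2) for every $u \in V(G)$, $H[L(u)]$ is complete; (3) if $E_H(L(u),L(v))$ is nonempty, then $u=v$ or $uv \in E(G)$; (4) if $uv \in E(G)$, then $E_H(L(u),L(v))$ is a matching (possibly empty). The cover is $m$-fold if $|L(u)|=m$ for all $u$. An $\mathcal{H}$-coloring of $G$ is an independent set in $H$ of size $|V(G)|$. $P_{DP}(G,\mathcal{H})$ is the number of $\mathcal{H}$-colorings, and $P_{DP}(G,m)$ is the minimum of $P_{DP}(G,\mathcal{H})$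 over all $m$-fold covers $\mathcal{H}$ of $G$. *)

theory Defs
  imports
    "Graph_Theory.Pair_Digraph"
    "HOL-Library.Disjoint_Sets"
    "HOL-Library.FuncSet"
begin

text \<open>
  A finite simple graph is a \<^locale>\<open>pair_graph\<close>: a finite, loop-free, symmetric set of arcs; the
  edge \<open>uv\<close> is represented by the two arcs \<open>(u, v)\<close> and \<open>(v, u)\<close>.
\<close>


section \<open>Generalized Theta graphs\<close>

datatype theta_vertex = End1 | End2 | Inner nat nat

text \<open>
  \<open>theta_path l i j\<close> is the vertex at distance \<open>j\<close> from \<open>End1\<close> along the \<open>i\<close>-th path, which has
  \<open>l i\<close> edges. This is meaningful for \<open>l i \<ge> 1\<close> and \<open>j \<le> l i\<close>.
\<close>

definition theta_path :: "(nat \<Rightarrow> nat) \<Rightarrow> nat \<Rightarrow> nat \<Rightarrow> theta_vertex" where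
  "theta_path l i j = (if j = 0 then End1 else if j = l i then End2 else Inner i j)"

definition theta_graph :: "nat \<Rightarrow> (nat \<Rightarrow> nat) \<Rightarrow> theta_vertex pair_pre_digraph" where
  "theta_graph k l =
    \<lparr> pverts = {End1, End2} \<union> {theta_path l i j | i j. i \<in> {1..k} \<and> j \<le> l i},
      parcs = {(theta_path l i j, theta_path l i (Suc j)) | i j. i \<in> {1..k} \<and> j < l i} \<union>
              {(theta_path l i (Suc j), theta_path l i j) | i j. i \<in> {1..k} \<and> j < l i} \<rparr>"


section \<open>The chromatic polynomial\<close>

definition proper_colorings :: "'a pair_pre_digraph \<Rightarrow> nat \<Rightarrow> ('a \<Rightarrow> nat) set" where
  "proper_colorings G m = {c \<in> pverts G \<rightarrow>\<^sub>E {1..m}. \<forall>(u, v) \<in> parcs G. c u \<noteq> c v}"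

text \<open>The value at the natural number \<open>m\<close> of the chromatic polynomial of \<open>G\<close>.\<close>

definition chromatic_polynomial :: "'a pair_pre_digraph \<Rightarrow> nat \<Rightarrow> nat" where
  "chromatic_polynomial G m = card (proper_colorings G m)"


section \<open>Covers and the DP color function\<close>

definition edges_between :: "'b pair_pre_digraph \<Rightarrow> 'b set \<Rightarrow> 'b set \<Rightarrow> 'b set set" where
  "edges_between H A B = {{x, y} | x y. x \<in> A \<and> y \<in> B \<and> (x, y) \<in> parcs H}"

definition is_matching :: "'b set set \<Rightarrow> bool" where
  "is_matching M \<longleftrightarrow> pairwise disjnt M"

definition is_clique :: "'b pair_pre_digraph \<Rightarrow> 'b set \<Rightarrow> bool" where
  "is_clique H A \<longleftrightarrow> (\<forall>x\<in>A. \<forall>y\<in>A. x \<noteq> y \<longrightarrow> (x, y) \<in> parcs H)"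

definition is_independent :: "'b pair_pre_digraph \<Rightarrow> 'b set \<Rightarrow> bool" where
  "is_independent H I \<longleftrightarrow> I \<subseteq> pverts H \<and> (\<forall>x\<in>I. \<forall>y\<in>I. (x, y) \<notin> parcs H)"

text \<open>
  Injectivity of \<open>L\<close> expresses that the sets \<open>L u\<close> partition the vertices of \<open>H\<close> as a family
  indexed by the vertices of \<open>G\<close>, so that different vertices of \<open>G\<close> have disjoint sets.
\<close>

definition is_cover ::
  "'a pair_pre_digraph \<Rightarrow> ('a \<Rightarrow> 'b set) \<Rightarrow> 'b pair_pre_digraph \<Rightarrow> bool" where
  "is_cover G L H \<longleftrightarrow>
     pair_graph H \<and>
     partition_on (pverts H) (L ` pverts G) \<and> inj_on L (pverts G) \<and>
     (\<forall>u \<in> pverts G. is_clique H (L u)) \<and>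
     (\<forall>u \<in> pverts G. \<forall>v \<in> pverts G.
        edges_between H (L u) (L v) \<noteq> {} \<longrightarrow> u = v \<or> (u, v) \<in> parcs G) \<and>
     (\<forall>(u, v) \<in> parcs G. is_matching (edges_between H (L u) (L v)))"

definition is_fold_cover ::
  "nat \<Rightarrow> 'a pair_pre_digraph \<Rightarrow> ('a \<Rightarrow> 'b set) \<Rightarrow> 'b pair_pre_digraph \<Rightarrow> bool" where
  "is_fold_cover m G L H \<longleftrightarrow> is_cover G L H \<and> (\<forall>u \<in> pverts G. card (L u) = m)"

definition cover_colorings :: "'a pair_pre_digraph \<Rightarrow> 'b pair_pre_digraph \<Rightarrow> 'b set set" where
  "cover_colorings G H = {I. is_independent H I \<and> card I = card (pverts G)}"

text \<open>
  The cover graphs range over graphs with natural numbers as vertices. As cover graphs are finite,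
  this loses no generality: see \<open>dp_color_function_le\<close> for covers with vertices of any type, and
  \<open>dp_color_function_attained\<close> for the infimum being a minimum.
\<close>

definition dp_color_function :: "'a pair_pre_digraph \<Rightarrow> nat \<Rightarrow> nat" where
  "dp_color_function G m =
     Inf {card (cover_colorings G H) | (L :: 'a \<Rightarrow> nat set) H. is_fold_cover m G L H}"


section \<open>Basic facts\<close>

lemma pair_graph_iff:
  "pair_graph G \<longleftrightarrow> finite (pverts G) \<and> parcs G \<subseteq> pverts G \<times> pverts G \<and> sym (parcs G) \<and>
     irrefl (parcs G)"
proof
  assume "pair_graph G"
  then interpret pair_graph G .
  show "finite (pverts G) \<and> parcs G \<subseteq> pverts G \<times> pverts G \<and> sym (parcs G) \<and> irrefl (parcs G)"
    using pair_finite_verts pair_sym_arcs pair_no_loops arc_fst_in_verts arc_snd_in_verts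
    by (fastforce simp: symmetric_def irrefl_def)
next
  assume a: "finite (pverts G) \<and> parcs G \<subseteq> pverts G \<times> pverts G \<and> sym (parcs G) \<and>
    irrefl (parcs G)"
  then have "finite (parcs G)"
    using finite_subset by blast
  with a show "pair_graph G"
    by unfold_locales (auto simp: symmetric_def irrefl_def)
qed

lemma pair_graph_theta_graph: "pair_graph (theta_graph k l)"
proof -
  let ?V = "pverts (theta_graph k l)" and ?E = "parcs (theta_graph k l)"
  have "{theta_path l i j | i j. i \<in> {1..k} \<and> j \<le> l i} =
      (\<Union>i\<in>{1..k}. theta_path l i ` {..l i})"
    by blast
  then have fin: "finite ?V"
    by (simp only: theta_graph_def pair_pre_digraph.simps) simp
  have path_in: "theta_path l i j \<in> ?V" if "i \<in> {1..k}" "j \<le> l i" for i j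
    using that by (simp only: theta_graph_def pair_pre_digraph.simps) blast
  have arc: "\<exists>i j. i \<in> {1..k} \<and> j < l i \<and>
      (e = (theta_path l i j, theta_path l i (Suc j)) \<or>
       e = (theta_path l i (Suc j), theta_path l i j))" if "e \<in> ?E" for e
    using that by (simp only: theta_graph_def pair_pre_digraph.simps) blast
  have "?E \<subseteq> ?V \<times> ?V"
  proof
    fix e assume "e \<in> ?E"
    from arc[OF this] show "e \<in> ?V \<times> ?V"
      using path_in by (metis Suc_leI less_imp_le_nat mem_Sigma_iff)
  qed
  moreover have "sym ?E"
    by (rule symI, simp only: theta_graph_def pair_pre_digraph.simps) blast
  moreover have "irrefl ?E"
    unfolding irrefl_def
  proof (intro allI notI)
    fix a assume "(a, a) \<in> ?E"
    from arc[OF this] obtain i j where "theta_path l i j = theta_path l i (Suc j)" "j < l i"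
      by (metis prod.inject)
    then show False
      by (auto simp: theta_path_def split: if_splits)
  qed
  ultimately show ?thesis
    using fin by (simp add: pair_graph_iff)
qed

lemma is_fold_cover_relabel:
  assumes G: "pair_graph G" and C: "is_fold_cover m G L H" and f: "inj_on f (pverts H)"
  defines "H' \<equiv> \<lparr> pverts = f ` pverts H, parcs = map_prod f f ` parcs H \<rparr>"
  shows "is_fold_cover m G (\<lambda>u. f ` L u) H'"
    and "card (cover_colorings G H') = card (cover_colorings G H)"
proof -
  have H: "finite (pverts H)" "parcs H \<subseteq> pverts H \<times> pverts H" "sym (parcs H)" "irrefl (parcs H)"
    and part: "partition_on (pverts H) (L ` pverts G)" and inj: "inj_on L (pverts G)"
    and C': "\<forall>u\<in>pverts G. is_clique H (L u)"
      "\<forall>u \<in> pverts G. \<forall>v \<in> pverts G.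
        edges_between H (L u) (L v) \<noteq> {} \<longrightarrow> u = v \<or> (u, v) \<in> parcs G"
      "\<forall>(u, v) \<in> parcs G. is_matching (edges_between H (L u) (L v))"
      "\<forall>u \<in> pverts G. card (L u) = m"
    using C by (auto simp: is_fold_cover_def is_cover_def pair_graph_iff)
  have sub: "L u \<subseteq> pverts H" if "u \<in> pverts G" for u
    using part that by (auto simp: partition_on_def)
  have arc: "(f x, f y) \<in> parcs H' \<longleftrightarrow> (x, y) \<in> parcs H"
    if "x \<in> pverts H" "y \<in> pverts H" for x y
  proof
    assume "(f x, f y) \<in> parcs H'"
    then obtain x' y' where xy: "(x', y') \<in> parcs H" "f x = f x'" "f y = f y'"
      by (auto simp: H'_def)
    moreover have "x' \<in> pverts H" "y' \<in> pverts H"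
      using xy(1) H(2) by auto
    ultimately have "x = x'" "y = y'"
      using that f by (metis inj_onD)+
    then show "(x, y) \<in> parcs H"
      using xy by simp
  next
    assume "(x, y) \<in> parcs H"
    then show "(f x, f y) \<in> parcs H'"
      by (force simp: H'_def)
  qed
  have "pair_graph H'"
    unfolding pair_graph_iff
  proof (intro conjI)
    show "finite (pverts H')" "parcs H' \<subseteq> pverts H' \<times> pverts H'"
      using H by (auto simp: H'_def)
    show "sym (parcs H')"
      using H(3) unfolding H'_def sym_def by force
    show "irrefl (parcs H')"
      unfolding irrefl_def
    proof (intro allI notI)
      fix a assume a: "(a, a) \<in> parcs H'"
      then obtain x where "a = f x" "x \<in> pverts H"
        using H(2) by (auto simp: H'_def)
      with a arc H(4) show False
        by (auto simp: irrefl_def)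
    qed
  qed
  moreover have inj': "inj_on ((`) f \<circ> L) (pverts G)"
    using inj sub f by (auto simp: inj_on_def inj_on_image_eq_iff)
  moreover have "partition_on (pverts H') ((\<lambda>u. f ` L u) ` pverts G)"
  proof -
    have "{} \<notin> (\<lambda>u. f ` L u) ` pverts G"
      using partition_onD3[OF part] by auto
    then show ?thesis
      using partition_on_inj_image[OF part f] by (simp add: H'_def image_image)
  qed
  moreover have "is_clique H' (f ` L u)" if "u \<in> pverts G" for u
    unfolding is_clique_def
  proof (intro ballI impI)
    fix a b assume "a \<in> f ` L u" "b \<in> f ` L u" "a \<noteq> b"
    then obtain x y where "x \<in> L u" "y \<in> L u" "x \<noteq> y" "a = f x" "b = f y"
      by auto
    moreover from this have "(x, y) \<in> parcs H"
      using C'(1) that by (simp add: is_clique_def)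
    ultimately show "(a, b) \<in> parcs H'"
      using arc sub[OF that] by auto
  qed
  moreover have eb: "edges_between H' (f ` L u) (f ` L v) = (`) f ` edges_between H (L u) (L v)"
    if "u \<in> pverts G" "v \<in> pverts G" for u v
  proof -
    have "edges_between H' (f ` L u) (f ` L v) =
        {{f x, f y} | x y. x \<in> L u \<and> y \<in> L v \<and> (f x, f y) \<in> parcs H'}"
      by (auto simp: edges_between_def)
    also have "\<dots> = {{f x, f y} | x y. x \<in> L u \<and> y \<in> L v \<and> (x, y) \<in> parcs H}"
      using sub[OF that(1)] sub[OF that(2)] arc by (intro Collect_cong ex_cong1 conj_cong refl) blast
    also have "\<dots> = (`) f ` edges_between H (L u) (L v)"
      by (auto simp: edges_between_def image_def)
    finally show ?thesis .
  qed
  moreover have "is_matching (edges_between H' (f ` L u) (f ` L v))" if "(u, v) \<in> parcs G" for u v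
  proof -
    have uv: "u \<in> pverts G" "v \<in> pverts G"
      using G that by (auto simp: pair_graph_iff)
    have sub': "e \<subseteq> pverts H" if "e \<in> edges_between H (L u) (L v)" for e
      using that H(2) by (auto simp: edges_between_def)
    have "pairwise disjnt (edges_between H (L u) (L v))"
      using C'(3) \<open>(u, v) \<in> parcs G\<close> by (auto simp: is_matching_def)
    then have disj: "d \<inter> e = {}" if "d \<in> edges_between H (L u) (L v)"
      "e \<in> edges_between H (L u) (L v)" "d \<noteq> e" for d e
      using pairwiseD[of disjnt] that unfolding disjnt_def by metis
    show ?thesis
      unfolding eb[OF uv] is_matching_def
    proof (rule pairwiseI)
      fix d' e'
      assume "d' \<in> (`) f ` edges_between H (L u) (L v)"
        "e' \<in> (`) f ` edges_between H (L u) (L v)" "d' \<noteq> e'"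
      then obtain d e where de: "d \<in> edges_between H (L u) (L v)"
        "e \<in> edges_between H (L u) (L v)" "d \<noteq> e" "d' = f ` d" "e' = f ` e"
        by blast
      then show "disjnt d' e'"
        using inj_on_image_Int[OF f sub'[OF de(1)] sub'[OF de(2)]] disj[OF de(1-3)]
        by (simp add: disjnt_def)
    qed
  qed
  moreover have "card (f ` L u) = m" if "u \<in> pverts G" for u
    using C'(4) that card_image[OF inj_on_subset[OF f sub[OF that]]] by simp
  moreover have "u = v \<or> (u, v) \<in> parcs G" if "u \<in> pverts G" "v \<in> pverts G"
    "edges_between H' (f ` L u) (f ` L v) \<noteq> {}" for u v
    using C'(2) that eb[OF that(1,2)] by simp
  ultimately show "is_fold_cover m G (\<lambda>u. f ` L u) H'"
    unfolding is_fold_cover_def is_cover_def comp_def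
    by (intro conjI ballI impI) (simp_all add: split_beta)
  have ind: "is_independent H' (f ` I) \<longleftrightarrow> is_independent H I" if "I \<subseteq> pverts H" for I
    using that arc by (auto simp: is_independent_def H'_def subset_iff)
  have cd: "card (f ` I) = card I" if "I \<subseteq> pverts H" for I
    using card_image[OF inj_on_subset[OF f that]] .
  have "cover_colorings G H' = (`) f ` cover_colorings G H"
  proof (intro equalityI subsetI)
    fix J assume J: "J \<in> cover_colorings G H'"
    then have "J \<subseteq> f ` pverts H"
      by (auto simp: cover_colorings_def is_independent_def H'_def)
    then obtain I where "I \<subseteq> pverts H" "J = f ` I"
      by (meson subset_imageE)
    with J ind cd show "J \<in> (`) f ` cover_colorings G H"
      by (auto simp: cover_colorings_def)
  next
    fix J assume "J \<in> (`) f ` cover_colorings G H"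
    then obtain I where I: "I \<in> cover_colorings G H" "J = f ` I"
      by auto
    then have "I \<subseteq> pverts H"
      by (auto simp: cover_colorings_def is_independent_def)
    with I ind cd show "J \<in> cover_colorings G H'"
      by (auto simp: cover_colorings_def)
  qed
  moreover have "inj_on ((`) f) (cover_colorings G H)"
    by (rule inj_on_subset[OF inj_on_image_Pow[OF f]])
       (auto simp: cover_colorings_def is_independent_def)
  ultimately show "card (cover_colorings G H') = card (cover_colorings G H)"
    by (simp add: card_image)
qed

lemma is_fold_cover_nat:
  assumes "pair_graph G" and "is_fold_cover m G L H"
  obtains L' :: "'a \<Rightarrow> nat set" and H' where "is_fold_cover m G L' H'"
    "card (cover_colorings G H') = card (cover_colorings G H)"
proof -
  have "finite (pverts H)"
    using assms by (auto simp: is_fold_cover_def is_cover_def pair_graph_iff)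
  then obtain f :: "'b \<Rightarrow> nat" where "inj_on f (pverts H)"
    using finite_imp_inj_to_nat_seg by metis
  note relabel = is_fold_cover_relabel[OF assms this]
  show thesis
    by (rule that[OF relabel])
qed

lemma dp_color_function_le:
  fixes G :: "'a pair_pre_digraph" and L :: "'a \<Rightarrow> 'b set"
  assumes "pair_graph G" and "is_fold_cover m G L H"
  shows "dp_color_function G m \<le> card (cover_colorings G H)"
proof -
  obtain L' :: "'a \<Rightarrow> nat set" and H' where "is_fold_cover m G L' H'"
    "card (cover_colorings G H') = card (cover_colorings G H)"
    using is_fold_cover_nat[OF assms] .
  then have "card (cover_colorings G H) \<in>
      {card (cover_colorings G H) | (L :: 'a \<Rightarrow> nat set) H. is_fold_cover m G L H}"
    by (metis (mono_tags, lifting) mem_Collect_eq)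
  then show ?thesis
    unfolding dp_color_function_def by (intro cInf_lower) simp_all
qed

lemma ex_fold_cover:
  fixes G :: "'a pair_pre_digraph"
  assumes "pair_graph G" and "1 \<le> m"
  shows "\<exists>(L :: 'a \<Rightarrow> ('a \<times> nat) set) H. is_fold_cover m G L H"
proof -
  define L :: "'a \<Rightarrow> ('a \<times> nat) set" where "L u = {u} \<times> {..<m}" for u
  define H where "H = \<lparr> pverts = pverts G \<times> {..<m},
    parcs = {((u, a), (v, b)). u = v \<and> u \<in> pverts G \<and> a < m \<and> b < m \<and> a \<noteq> b} \<rparr>"
  have "pair_graph H"
    using assms(1) by (auto simp: pair_graph_iff H_def sym_def irrefl_def)
  moreover have ne: "(u, 0) \<in> L v \<longleftrightarrow> u = v" for u v
    using assms(2) by (auto simp: L_def)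
  moreover have "partition_on (pverts H) (L ` pverts G)"
  proof (rule partition_onI)
    show "{} \<notin> L ` pverts G"
      using ne by (metis empty_iff imageE)
  qed (auto simp: L_def H_def disjnt_def)
  moreover have "inj_on L (pverts G)"
    using ne by (metis inj_onI)
  moreover have "\<forall>u \<in> pverts G. is_clique H (L u)"
    by (auto simp: is_clique_def L_def H_def)
  moreover have "edges_between H (L u) (L v) = {}" if "u \<noteq> v" for u v
    using that by (auto simp: edges_between_def L_def H_def)
  moreover have "u \<noteq> v" if "(u, v) \<in> parcs G" for u v
    using that assms(1) by (auto simp: pair_graph_iff irrefl_def)
  moreover have "\<forall>u \<in> pverts G. card (L u) = m"
    by (simp add: L_def)
  ultimately have "is_fold_cover m G L H"
    by (auto simp: is_fold_cover_def is_cover_def is_matching_def)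
  then show ?thesis
    by blast
qed

lemma dp_color_function_attained:
  fixes G :: "'a pair_pre_digraph"
  assumes "pair_graph G" and "1 \<le> m"
  shows "\<exists>(L :: 'a \<Rightarrow> nat set) H. is_fold_cover m G L H \<and>
    dp_color_function G m = card (cover_colorings G H)"
proof -
  let ?S = "{card (cover_colorings G H) | (L :: 'a \<Rightarrow> nat set) H. is_fold_cover m G L H}"
  obtain L :: "'a \<Rightarrow> ('a \<times> nat) set" and H where C: "is_fold_cover m G L H"
    using ex_fold_cover[OF assms] by blast
  obtain L' :: "'a \<Rightarrow> nat set" and H' where "is_fold_cover m G L' H'"
    using is_fold_cover_nat[OF assms(1) C] by blast
  then have "?S \<noteq> {}"
    by blast
  then have "Inf ?S \<in> ?S"
    by (rule Inf_nat_def1)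
  then show ?thesis
    unfolding dp_color_function_def by blast
qed

end

theory Submission
  imports Defs Complex_Main
begin

text \<open>
  Fix an \<open>m\<close>-fold cover; its matchings may be assumed perfect. A path of length \<open>n\<close> then induces a
  bijection between the colors of its two ends, and the number of ways to extend colors \<open>a\<close>, \<open>b\<close> of
  the ends along it is \<open>A n\<close> if the bijection maps \<open>a\<close> to \<open>b\<close>, and \<open>B n\<close> otherwise, where
  \<open>A n - B n = (-1) ^ n\<close> and \<open>B (n + 1)\<close> exceeds \<open>B n\<close> by a factor of about \<open>m\<close>. For a set \<open>S\<close> of paths let
  \<open>e S = (\<Prod>i\<in>S. A (l i) / B (l i)) - 1\<close>. For a fixed color \<open>a\<close> of the first end, the images of \<open>a\<close>
  partition the paths into blocks, and the number of colorings is \<open>(\<Prod>i. B (l i)) * (m + \<Sigma>)\<close>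
  where \<open>\<Sigma>\<close> is the sum of the \<open>e S\<close> over the blocks \<open>S\<close>. Proper colorings have a single block.

  Merging disjoint blocks \<open>S\<close> and \<open>T\<close> changes this sum by \<open>e S * e T\<close>. As path 1 is a shortest one, for
  large \<open>m\<close> the sign of \<open>e S\<close> is that of \<open>(-1) ^ l 1\<close> whenever \<open>S\<close> contains it. If all other paths
  have the opposite parity, merging everything into the block of path 1 can thus only decrease the
  count; if path \<open>j\<close> has the same parity, splitting it off by a cyclic shift strictly decreases it.
\<close>

section \<open>Walks\<close>

text \<open>
  The numbers \<open>A n\<close> and \<open>B n\<close> above, meaningful for \<open>m \<ge> 2\<close>; they also count the walks of length \<open>n\<close>
  in the complete graph on \<open>m\<close> vertices between equal and between different end vertices.
\<close>

fun walks_eq :: "nat \<Rightarrow> nat \<Rightarrow> nat" and walks_neq :: "nat \<Rightarrow> nat \<Rightarrow> nat" where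
  "walks_eq m 0 = 1"
| "walks_eq m (Suc n) = (m - 1) * walks_neq m n"
| "walks_neq m 0 = 0"
| "walks_neq m (Suc n) = walks_eq m n + (m - 2) * walks_neq m n"

primrec path_map :: "(nat \<Rightarrow> 'b \<Rightarrow> 'b) \<Rightarrow> nat \<Rightarrow> 'b \<Rightarrow> 'b" where
  "path_map f 0 x = x"
| "path_map f (Suc n) x = f n (path_map f n x)"

text \<open>The colorings of a path with lists \<open>L j\<close> in which no color is followed by
  its partner under the matching \<open>f j\<close>. Extensionality ensures that each coloring is
  counted once.\<close>

definition walks :: "(nat \<Rightarrow> 'b set) \<Rightarrow> (nat \<Rightarrow> 'b \<Rightarrow> 'b) \<Rightarrow> nat \<Rightarrow> 'b \<Rightarrow> 'b \<Rightarrow> (nat \<Rightarrow> 'b) set" where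
  "walks L f n a b =
    {w \<in> Pi\<^sub>E {..n} L. w 0 = a \<and> w n = b \<and> (\<forall>j<n. w (Suc j) \<noteq> f j (w j))}"

lemma path_map_in:
  assumes "\<And>j. j < n \<Longrightarrow> f j ` L j \<subseteq> L (Suc j)" and "a \<in> L 0"
  shows "path_map f n a \<in> L n"
  using assms by (induction n) (auto simp: image_subset_iff)

lemma finite_walks:
  assumes "\<And>j. j \<le> n \<Longrightarrow> finite (L j)"
  shows "finite (walks L f n a b)"
  by (rule finite_subset[OF _ finite_PiE[of "{..n}" L]]) (auto simp: walks_def assms)

lemma walks_Suc:
  assumes "b \<in> L (Suc n)"
  shows "walks L f (Suc n) a b =
    (\<lambda>w. w(Suc n := b)) ` (\<Union>c\<in>{c \<in> L n. f n c \<noteq> b}. walks L f n a c)"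
proof (intro equalityI subsetI)
  fix w assume w: "w \<in> walks L f (Suc n) a b"
  then have "restrict w {..n} \<in> walks L f n a (w n)"
    by (auto simp: walks_def)
  moreover have "w n \<in> L n" "f n (w n) \<noteq> b"
    using w by (auto simp: walks_def)
  moreover have "w = (restrict w {..n})(Suc n := b)"
    using w by (auto simp: walks_def fun_eq_iff PiE_iff extensional_def le_Suc_eq)
  ultimately show "w \<in> (\<lambda>w. w(Suc n := b)) ` (\<Union>c\<in>{c \<in> L n. f n c \<noteq> b}. walks L f n a c)"
    by blast
next
  fix w assume "w \<in> (\<lambda>w. w(Suc n := b)) ` (\<Union>c\<in>{c \<in> L n. f n c \<noteq> b}. walks L f n a c)"
  then show "w \<in> walks L f (Suc n) a b"
    using assms by (auto simp: walks_def PiE_iff extensional_def less_Suc_eq le_Suc_eq)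
qed

text \<open>Exactly one color \<open>c\<close> of the next-to-last list is matched to
  \<open>b\<close>, so the next-to-last color ranges over the \<open>m - 1\<close> others. If
  \<open>c\<close> is the image of \<open>a\<close>, each of them contributes
  \<open>walks_neq m n\<close>; otherwise the image is among them and contributes
  \<open>walks_eq m n\<close>, and the remaining \<open>m - 2\<close> contribute
  \<open>walks_neq m n\<close>. These are the defining recursions.\<close>

lemma card_walks:
  assumes "2 \<le> m" and "\<And>j. j \<le> n \<Longrightarrow> finite (L j)" and "\<And>j. j \<le> n \<Longrightarrow> card (L j) = m"
    and "\<And>j. j < n \<Longrightarrow> bij_betw (f j) (L j) (L (Suc j))" and "a \<in> L 0" and "b \<in> L n"
  shows "card (walks L f n a b) = (if b = path_map f n a then walks_eq m n else walks_neq m n)"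
  using assms(2-)
proof (induction n arbitrary: b)
  case 0
  have "walks L f 0 a b = (if b = a then {\<lambda>x\<in>{..0}. a} else {})"
    using 0 by (auto simp: walks_def PiE_iff extensional_def)
  then show ?case by simp
next
  case (Suc n)
  let ?p = "path_map f n a"
  have p: "?p \<in> L n"
    using Suc.prems by (intro path_map_in) (auto simp: bij_betw_def)
  have bij: "bij_betw (f n) (L n) (L (Suc n))"
    using Suc.prems by simp
  then obtain c where c: "c \<in> L n" "f n c = b"
    using Suc.prems(5) by (metis bij_betw_def imageE)
  have eq_c: "f n x = b \<longleftrightarrow> x = c" if "x \<in> L n" for x
    using bij c that by (auto simp: bij_betw_def inj_on_def)
  \<comment> \<open>Walks of length \<open>n\<close> are all undefined at \<open>Suc n\<close>, so
    overwriting that value loses nothing.\<close>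
  have inj: "inj_on (\<lambda>w. w(Suc n := b)) (\<Union>c\<in>L n - {c}. walks L f n a c)"
  proof (rule inj_onI)
    fix v w
    assume "v \<in> (\<Union>c\<in>L n - {c}. walks L f n a c)" "w \<in> (\<Union>c\<in>L n - {c}. walks L f n a c)"
      and eq: "v(Suc n := b) = w(Suc n := b)"
    then have "v (Suc n) = w (Suc n)"
      by (auto simp: walks_def PiE_iff extensional_def)
    with eq show "v = w"
      by (metis fun_upd_triv fun_upd_upd)
  qed
  have "{c \<in> L n. f n c \<noteq> b} = L n - {c}"
    using eq_c by auto
  then have "card (walks L f (Suc n) a b) = card (\<Union>c\<in>L n - {c}. walks L f n a c)"
    using walks_Suc[of b L n f a] Suc.prems(5) inj by (simp add: card_image)
  also have "\<dots> = (\<Sum>c\<in>L n - {c}. card (walks L f n a c))"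
  proof (rule card_UN_disjoint)
    show "\<forall>d\<in>L n - {c}. finite (walks L f n a d)"
      using Suc.prems(1) by (auto intro: finite_walks)
  qed (use Suc.prems(1) in \<open>auto simp: walks_def\<close>)
  also have "\<dots> = (\<Sum>c\<in>L n - {c}. if c = ?p then walks_eq m n else walks_neq m n)"
    using Suc.prems by (intro sum.cong refl Suc.IH) auto
  also have "\<dots> = (if b = path_map f (Suc n) a then walks_eq m (Suc n) else walks_neq m (Suc n))"
  proof (cases "c = ?p")
    case True
    then show ?thesis
      using c Suc.prems(1,2) by (simp add: sum.If_cases)
  next
    case False
    have "L n - {c} = insert ?p (L n - {c, ?p})" "card (L n - {c, ?p}) = m - 2"
      using False p c Suc.prems(1,2) by (auto simp: card_Diff_subset)
    moreover have "(\<Sum>x\<in>L n - {c, ?p}. if x = ?p then walks_eq m n else walks_neq m n) =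
        (\<Sum>x\<in>L n - {c, ?p}. walks_neq m n)"
      by (intro sum.cong) auto
    ultimately show ?thesis
      using False eq_c[OF p] Suc.prems(1) by simp
  qed
  finally show ?case .
qed

section \<open>Colorings of theta graphs along fixed bijections\<close>

text \<open>For bijective \<open>F i j\<close> these are the colorings for a cover with perfect
  matchings: every edge is directed from \<open>End1\<close> towards \<open>End2\<close>, and
  \<open>F i j\<close> maps the color at its start to the color forbidden at its end.\<close>

definition theta_colorings ::
  "nat \<Rightarrow> (nat \<Rightarrow> nat) \<Rightarrow> (theta_vertex \<Rightarrow> 'b set) \<Rightarrow> (nat \<Rightarrow> nat \<Rightarrow> 'b \<Rightarrow> 'b) \<Rightarrow>
    (theta_vertex \<Rightarrow> 'b) set" where
  "theta_colorings k l L F =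
    {c \<in> Pi\<^sub>E (pverts (theta_graph k l)) L.
      \<forall>i\<in>{1..k}. \<forall>j<l i. c (theta_path l i (Suc j)) \<noteq> F i j (c (theta_path l i j))}"

lemma pverts_theta_graph:
  "pverts (theta_graph k l) = {End1, End2} \<union> {theta_path l i j | i j. i \<in> {1..k} \<and> j \<le> l i}"
  by (simp only: theta_graph_def pair_pre_digraph.simps)

lemma theta_path_in: "i \<in> {1..k} \<Longrightarrow> j \<le> l i \<Longrightarrow> theta_path l i j \<in> pverts (theta_graph k l)"
  unfolding pverts_theta_graph by blast

lemma finite_pverts_theta_graph: "finite (pverts (theta_graph k l))"
  using pair_graph_theta_graph[of k l] by (simp add: pair_graph_iff)

lemma pverts_theta_graph_cases:
  assumes "u \<in> pverts (theta_graph k l)"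
  obtains "u = End1" | "u = End2"
    | i j where "i \<in> {1..k}" "0 < j" "j < l i" "u = Inner i j" "theta_path l i j = Inner i j"
  using assms unfolding pverts_theta_graph theta_path_def
  by (auto split: if_splits simp: le_less)

text \<open>Once the colors of the two ends are fixed, inner vertices of different paths do not
  interact, so a coloring amounts to an independent choice of one walk per path.\<close>

lemma card_theta_colorings_ends:
  assumes "2 \<le> m" and l: "\<And>i. i \<in> {1..k} \<Longrightarrow> 1 \<le> l i"
    and L: "\<And>u. u \<in> pverts (theta_graph k l) \<Longrightarrow> finite (L u)"
      "\<And>u. u \<in> pverts (theta_graph k l) \<Longrightarrow> card (L u) = m"
    and F: "\<And>i j. i \<in> {1..k} \<Longrightarrow> j < l i \<Longrightarrow>
      bij_betw (F i j) (L (theta_path l i j)) (L (theta_path l i (Suc j)))"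
    and ab: "a \<in> L End1" "b \<in> L End2"
  shows "card {c \<in> theta_colorings k l L F. c End1 = a \<and> c End2 = b} =
    (\<Prod>i\<in>{1..k}. if b = path_map (F i) (l i) a then walks_eq m (l i) else walks_neq m (l i))"
proof -
  let ?V = "pverts (theta_graph k l)"
  let ?W = "\<lambda>i. walks (\<lambda>j. L (theta_path l i j)) (F i) (l i) a b"
  let ?to = "\<lambda>c. \<lambda>i\<in>{1..k}. \<lambda>j\<in>{..l i}. c (theta_path l i j)"
  \<comment> \<open>The ends receive \<open>a\<close> and \<open>b\<close> directly; the glued walks
    agree there because each starts at \<open>a\<close> and stops at \<open>b\<close>.\<close>
  let ?from = "\<lambda>w. \<lambda>u\<in>?V. case u of End1 \<Rightarrow> a | End2 \<Rightarrow> b | Inner i j \<Rightarrow> w i j"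
  have ends: "theta_path l i 0 = End1" "i \<in> {1..k} \<Longrightarrow> theta_path l i (l i) = End2" for i
    using l[of i] by (auto simp: theta_path_def)
  have V: "End1 \<in> ?V" "End2 \<in> ?V"
    by (auto simp: pverts_theta_graph)
  have from_path: "?from w (theta_path l i j) = w i j"
    if "w \<in> Pi\<^sub>E {1..k} ?W" "i \<in> {1..k}" "j \<le> l i" for w i j
  proof -
    have "w i \<in> ?W i" using that by auto
    then have "w i 0 = a" "w i (l i) = b" by (auto simp: walks_def)
    then show ?thesis
      using theta_path_in[of i k j l, OF that(2,3)] by (auto simp: theta_path_def)
  qed
  have "bij_betw ?to {c \<in> theta_colorings k l L F. c End1 = a \<and> c End2 = b} (Pi\<^sub>E {1..k} ?W)"
  proof (rule bij_betw_byWitness[where f' = ?from])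
    show "\<forall>c\<in>{c \<in> theta_colorings k l L F. c End1 = a \<and> c End2 = b}. ?from (?to c) = c"
    proof (intro ballI ext)
      fix c u assume c: "c \<in> {c \<in> theta_colorings k l L F. c End1 = a \<and> c End2 = b}"
      show "?from (?to c) u = c u"
      proof (cases "u \<in> ?V")
        case True
        then show ?thesis
          by (cases rule: pverts_theta_graph_cases) (use c V True in auto)
      next
        case False
        then show ?thesis
          using c by (auto simp: theta_colorings_def PiE_iff extensional_def)
      qed
    qed
    show "\<forall>w\<in>Pi\<^sub>E {1..k} ?W. ?to (?from w) = w"
    proof (intro ballI ext)
      fix w i j assume w: "w \<in> Pi\<^sub>E {1..k} ?W"
      show "?to (?from w) i j = w i j"
      proof (cases "i \<in> {1..k}")
        case True
        then have "w i \<in> ?W i" using w by auto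
        then show ?thesis
          using from_path[OF w True, of j] True by (auto simp: walks_def PiE_iff extensional_def)
      next
        case False
        then show ?thesis using w by (auto simp: PiE_iff extensional_def)
      qed
    qed
    show "?to ` {c \<in> theta_colorings k l L F. c End1 = a \<and> c End2 = b} \<subseteq> Pi\<^sub>E {1..k} ?W"
    proof (intro image_subsetI PiE_I)
      fix c i assume c: "c \<in> {c \<in> theta_colorings k l L F. c End1 = a \<and> c End2 = b}"
        and i: "i \<in> {1..k}"
      have "c (theta_path l i j) \<in> L (theta_path l i j)" if "j \<le> l i" for j
        using c theta_path_in[of i k j l, OF i that] by (auto simp: theta_colorings_def)
      then show "?to c i \<in> ?W i"
        using c i ends by (auto simp: walks_def theta_colorings_def)
    qed auto
    show "?from ` Pi\<^sub>E {1..k} ?W \<subseteq> {c \<in> theta_colorings k l L F. c End1 = a \<and> c End2 = b}"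
    proof (rule image_subsetI)
      fix w assume w: "w \<in> Pi\<^sub>E {1..k} ?W"
      have wi: "w i \<in> ?W i" if "i \<in> {1..k}" for i
        using w that by auto
      have "?from w \<in> Pi\<^sub>E ?V L"
      proof (rule PiE_I)
        fix u assume u: "u \<in> ?V"
        then show "?from w u \<in> L u"
        proof (cases rule: pverts_theta_graph_cases)
          case (3 i j)
          have "w i \<in> Pi\<^sub>E {..l i} (\<lambda>j. L (theta_path l i j))"
            using wi[OF 3(1)] by (simp add: walks_def)
          from PiE_mem[OF this, of j] have "w i j \<in> L (theta_path l i j)"
            using 3(3) by simp
          then show ?thesis using 3 u by simp
        qed (use ab V in auto)
      qed auto
      moreover have "?from w (theta_path l i (Suc j)) \<noteq> F i j (?from w (theta_path l i j))"
        if "i \<in> {1..k}" "j < l i" for i j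
        using from_path[OF w that(1)] that wi[OF that(1)] by (auto simp: walks_def)
      ultimately show "?from w \<in> {c \<in> theta_colorings k l L F. c End1 = a \<and> c End2 = b}"
        using V by (auto simp: theta_colorings_def)
    qed
  qed
  then have "card {c \<in> theta_colorings k l L F. c End1 = a \<and> c End2 = b} = card (Pi\<^sub>E {1..k} ?W)"
    by (rule bij_betw_same_card)
  also have "\<dots> = (\<Prod>i\<in>{1..k}. card (?W i))"
    by (rule card_PiE) simp
  also have "\<dots> = (\<Prod>i\<in>{1..k}.
      if b = path_map (F i) (l i) a then walks_eq m (l i) else walks_neq m (l i))"
  proof (intro prod.cong refl card_walks)
    fix i assume i: "i \<in> {1..k}"
    show "finite (L (theta_path l i j))" "card (L (theta_path l i j)) = m" if "j \<le> l i" for j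
      using L theta_path_in[of i k j l, OF i that] by auto
    show "bij_betw (F i j) (L (theta_path l i j)) (L (theta_path l i (Suc j)))" if "j < l i" for j
      using F[OF i that] .
    show "a \<in> L (theta_path l i 0)" "b \<in> L (theta_path l i (l i))"
      using ab ends i by auto
  qed (rule assms(1))
  finally show ?thesis .
qed

lemma finite_theta_colorings:
  assumes "\<And>u. u \<in> pverts (theta_graph k l) \<Longrightarrow> finite (L u)"
  shows "finite (theta_colorings k l L F)"
  by (rule finite_subset[OF _ finite_PiE[of "pverts (theta_graph k l)" L]])
    (auto simp: theta_colorings_def assms finite_pverts_theta_graph)

lemma card_theta_colorings:
  assumes "2 \<le> m" and "\<And>i. i \<in> {1..k} \<Longrightarrow> 1 \<le> l i"
    and L: "\<And>u. u \<in> pverts (theta_graph k l) \<Longrightarrow> finite (L u)"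
      "\<And>u. u \<in> pverts (theta_graph k l) \<Longrightarrow> card (L u) = m"
    and F: "\<And>i j. i \<in> {1..k} \<Longrightarrow> j < l i \<Longrightarrow>
      bij_betw (F i j) (L (theta_path l i j)) (L (theta_path l i (Suc j)))"
  shows "card (theta_colorings k l L F) = (\<Sum>a\<in>L End1. \<Sum>b\<in>L End2. \<Prod>i\<in>{1..k}.
    if b = path_map (F i) (l i) a then walks_eq m (l i) else walks_neq m (l i))"
proof -
  have V: "End1 \<in> pverts (theta_graph k l)" "End2 \<in> pverts (theta_graph k l)"
    by (auto simp: pverts_theta_graph)
  have "(\<lambda>c. (c End1, c End2)) ` theta_colorings k l L F \<subseteq> L End1 \<times> L End2"
    using V by (auto simp: theta_colorings_def)
  then have "card (theta_colorings k l L F) = (\<Sum>p\<in>L End1 \<times> L End2.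
      card {c \<in> theta_colorings k l L F. (c End1, c End2) = p})"
    using L V finite_theta_colorings[of k l L F]
    by (subst card_eq_sum, subst sum.group[symmetric, where g = "\<lambda>c. (c End1, c End2)"
          and T = "L End1 \<times> L End2"]) auto
  also have "\<dots> = (\<Sum>(a, b)\<in>L End1 \<times> L End2. \<Prod>i\<in>{1..k}.
      if b = path_map (F i) (l i) a then walks_eq m (l i) else walks_neq m (l i))"
    using card_theta_colorings_ends[where k = k and l = l and L = L and F = F, OF assms]
    by (intro sum.cong refl) auto
  also have "\<dots> = (\<Sum>a\<in>L End1. \<Sum>b\<in>L End2. \<Prod>i\<in>{1..k}.
      if b = path_map (F i) (l i) a then walks_eq m (l i) else walks_neq m (l i))"
    by (rule sum.cartesian_product[symmetric])
  finally show ?thesis .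
qed

section \<open>Comparing block structures\<close>

text \<open>The recursions give \<open>walks_eq m (Suc n) - walks_neq m (Suc n) = walks_neq m n -
  walks_eq m n\<close> over the reals, so the difference flips its sign at each step, starting from
  1.\<close>

lemma walks_eq_neq:
  assumes "2 \<le> m"
  shows "real (walks_eq m n) = real (walks_neq m n) + (-1) ^ n"
proof (induction n)
  case (Suc n)
  have "real (walks_eq m (Suc n)) = (real m - 1) * real (walks_neq m n)"
    using assms by (simp add: of_nat_diff)
  also have "\<dots> = real (walks_eq m n) + real (m - 2) * real (walks_neq m n) + (-1) ^ Suc n"
    using assms Suc by (simp add: of_nat_diff algebra_simps)
  also have "\<dots> = real (walks_neq m (Suc n)) + (-1) ^ Suc n"
    by simp
  finally show ?case .
qed simp

lemma walks_neq_Suc_ge: "(m - 2) * walks_neq m n \<le> walks_neq m (Suc n)"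
  by simp

lemma walks_neq_mono:
  assumes "3 \<le> m" and "n \<le> n'"
  shows "walks_neq m n \<le> walks_neq m n'"
  using assms(2)
proof (rule lift_Suc_mono_le[rotated])
  fix n
  have "1 * walks_neq m n \<le> (m - 2) * walks_neq m n"
    using assms(1) by (intro mult_right_mono) auto
  then show "walks_neq m n \<le> walks_neq m (Suc n)"
    using walks_neq_Suc_ge[of m n] by linarith
qed

text \<open>Makes the quotients in \<open>excess\<close> meaningful. The bound on \<open>m\<close>
  matters: for \<open>m = 2\<close> the count vanishes at every even \<open>n\<close>.\<close>

lemma walks_neq_pos:
  assumes "3 \<le> m" and "1 \<le> n"
  shows "1 \<le> walks_neq m n"
  using walks_neq_mono[OF assms] by simp

text \<open>This is \<open>e S\<close>. Subtracting 1 lets a color that no path leads to contribute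
  0, so that sums over blocks can run over all colors of the second end.\<close>

definition excess :: "nat \<Rightarrow> (nat \<Rightarrow> nat) \<Rightarrow> nat set \<Rightarrow> real" where
  "excess m l S = (\<Prod>i\<in>S. real (walks_eq m (l i)) / real (walks_neq m (l i))) - 1"

lemma excess_empty [simp]: "excess m l {} = 0"
  by (simp add: excess_def)

text \<open>\<open>1 + excess\<close> is multiplicative over disjoint unions; the cross term is the
  change caused by merging two blocks.\<close>

lemma excess_Un:
  assumes "finite S" "finite T" "S \<inter> T = {}"
  shows "excess m l (S \<union> T) = excess m l S + excess m l T + excess m l S * excess m l T"
  using assms by (simp add: excess_def prod.union_disjoint algebra_simps)

lemma walks_ratio:
  assumes "3 \<le> m" and "1 \<le> n"
  shows "real (walks_eq m n) / real (walks_neq m n) = 1 + (-1) ^ n / real (walks_neq m n)"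
  using walks_eq_neq[of m n] walks_neq_pos[OF assms] assms by (simp add: field_simps)

text \<open>By \<open>walks_ratio\<close> all factors lie on the same side of 1, hence so does their
  product.\<close>

lemma excess_sign:
  assumes "3 \<le> m" and "\<And>i. i \<in> S \<Longrightarrow> 1 \<le> l i" and "\<And>i. i \<in> S \<Longrightarrow> even (l i) \<longleftrightarrow> even n"
  shows "0 \<le> (-1) ^ n * excess m l S"
proof (cases "even n")
  case True
  have "1 \<le> (\<Prod>i\<in>S. real (walks_eq m (l i)) / real (walks_neq m (l i)))"
    using assms True by (intro prod_ge_1) (auto simp: walks_ratio)
  then show ?thesis using True by (simp add: excess_def)
next
  case False
  have "(\<Prod>i\<in>S. real (walks_eq m (l i)) / real (walks_neq m (l i))) \<le> 1"
    using assms False by (intro prod_le_1) (auto simp: walks_ratio divide_simps)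
  then show ?thesis using False by (simp add: excess_def)
qed

text \<open>The factor of \<open>p\<close> deviates from 1 by \<open>1 / walks_neq m (l p)\<close>.
  Paths of the same parity push the product further in the same direction. Paths of the other parity
  are strictly longer than \<open>p\<close>, so each opposes with a deviation smaller by a factor of
  at least \<open>m - 2\<close>, and at most \<open>k\<close> of them cannot compensate.\<close>

lemma excess_dominant_sign:
  assumes S: "finite S" "p \<in> S" "card S \<le> k" and m: "2 * k + 3 \<le> m" and "1 \<le> l p"
    and le: "\<And>i. i \<in> S \<Longrightarrow> l p \<le> l i"
  shows "0 < (-1) ^ l p * excess m l S"
proof -
  let ?B = "\<lambda>i. real (walks_neq m (l i))"
  let ?r = "\<lambda>i. real (walks_eq m (l i)) / ?B i"
  define x where "x = 1 / ?B p"
  \<comment> \<open>One more edge multiplies \<open>walks_neq\<close> by at least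
    \<open>m - 2\<close>, so \<open>y\<close> bounds the deviation of every path longer than
    \<open>p\<close>.\<close>
  define y where "y = x / real (m - 2)"
  have m3: "3 \<le> m" using m by simp
  have "1 \<le> ?B p"
    using walks_neq_pos[OF m3 \<open>1 \<le> l p\<close>] by simp
  then have x: "0 < x" "x \<le> 1"
    by (auto simp: x_def)
  then have y: "0 < y" "y \<le> 1"
    using m by (auto simp: y_def field_simps)
  \<comment> \<open>This is where \<open>2 * k + 3 \<le> m\<close> enters, as
    \<open>2 * k < m - 2\<close>. The factor 2 absorbs the cross term
    \<open>x * (real k * y)\<close> when \<open>l p\<close> is even.\<close>
  have ky: "2 * (real k * y) < x"
  proof -
    have "real (2 * k) < real (m - 2)"
      using m by (simp only: of_nat_less_iff)
    then have "x * real (2 * k) < x * real (m - 2)"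
      using x by (intro mult_strict_left_mono)
    then show ?thesis
      using m by (simp add: y_def field_simps)
  qed
  have bern: "1 - real k * y \<le> (1 - y) ^ k"
    using Bernoulli_inequality[of "- y" k] y by simp
  have small: "1 / ?B i \<le> y" if "i \<in> S" "even (l i) \<noteq> even (l p)" for i
  proof -
    have "l p \<noteq> l i" using that(2) by auto
    then have "Suc (l p) \<le> l i" using le[OF that(1)] by simp
    from walks_neq_mono[OF m3 this] have "(m - 2) * walks_neq m (l p) \<le> walks_neq m (l i)"
      using walks_neq_Suc_ge order_trans by blast
    then have "real (m - 2) * ?B p \<le> ?B i"
      by (metis of_nat_le_iff of_nat_mult)
    moreover have "0 < real (m - 2) * ?B p"
      using m \<open>1 \<le> ?B p\<close> by simp
    ultimately show ?thesis
      using frac_le[of 1 1 "real (m - 2) * ?B p" "?B i"]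
      by (simp add: y_def x_def mult.commute del: of_nat_diff)
  qed
  have li: "1 \<le> l i" if "i \<in> S" for i
    using le[OF that] \<open>1 \<le> l p\<close> by simp
  have ratio: "?r i = 1 + (-1) ^ l i / ?B i" if "i \<in> S" for i
    using walks_ratio[OF m3 li[OF that]] .
  have c: "card (S - {p}) \<le> k"
    using S by simp
  have split: "prod ?r S = ?r p * prod ?r (S - {p})"
    using S by (simp add: prod.remove)
  show ?thesis
  proof (cases "even (l p)")
    case True
    \<comment> \<open>In the worst case every factor other than that of \<open>p\<close> equals
      \<open>1 - y\<close>.\<close>
    have "(1 - y) ^ k \<le> (1 - y) ^ card (S - {p})"
      using y c by (intro power_decreasing) auto
    also have "\<dots> = (\<Prod>i\<in>S - {p}. 1 - y)" by simp
    also have "\<dots> \<le> prod ?r (S - {p})"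
    proof (intro prod_mono conjI)
      fix i assume i: "i \<in> S - {p}"
      show "1 - y \<le> ?r i"
      proof (cases "even (l i)")
        case e: True
        then have "1 \<le> ?r i" using ratio[of i] i by simp
        then show ?thesis using y by linarith
      next
        case False
        then show ?thesis using ratio[of i] small[of i] i True by simp
      qed
    qed (use y in auto)
    finally have "1 - real k * y \<le> prod ?r (S - {p})" using bern by linarith
    moreover have "?r p = 1 + x" using ratio[of p] S True by (simp add: x_def)
    ultimately have "(1 + x) * (1 - real k * y) \<le> prod ?r S"
      using x unfolding split by simp
    moreover have "x * (real k * y) \<le> real k * y"
      using x y by (intro mult_left_le_one_le) auto
    then have "1 < (1 + x) * (1 - real k * y)"
      using ky by (simp add: algebra_simps)
    ultimately show ?thesis using True by (simp add: excess_def)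
  next
    case False
    have "prod ?r (S - {p}) \<le> (\<Prod>i\<in>S - {p}. 1 + y)"
    proof (intro prod_mono conjI)
      fix i assume i: "i \<in> S - {p}"
      show "?r i \<le> 1 + y"
      proof (cases "even (l i)")
        case e: True
        then show ?thesis using ratio[of i] small[of i] i False by simp
      next
        case e: False
        then have "?r i \<le> 1" using ratio[of i] i by simp
        then show ?thesis using y by linarith
      qed
    qed auto
    also have "\<dots> = (1 + y) ^ card (S - {p})" by simp
    also have "\<dots> \<le> (1 + y) ^ k"
      using y c by (intro power_increasing) auto
    finally have "prod ?r (S - {p}) \<le> (1 + y) ^ k" .
    moreover have "?r p = 1 - x" using ratio[of p] S False by (simp add: x_def)
    ultimately have "prod ?r S \<le> (1 - x) * (1 + y) ^ k"
      using x unfolding split by (simp add: mult_left_mono)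
    \<comment> \<open>Since \<open>real k * y < x\<close>, Bernoulli's inequality gives
      \<open>1 - x < (1 - y) ^ k\<close>. Pairing this power with \<open>(1 + y) ^ k\<close> yields
      \<open>(1 - y * y) ^ k\<close>, so no separate upper bound on \<open>(1 + y) ^ k\<close> is
      required.\<close>
    also have "\<dots> < (1 - y) ^ k * (1 + y) ^ k"
      using bern ky x y by (intro mult_strict_right_mono) auto
    also have "\<dots> = (1 - y * y) ^ k"
      by (simp add: power_mult_distrib[symmetric] algebra_simps)
    also have "\<dots> \<le> 1"
      using y by (intro power_le_one) (auto simp: mult_le_one)
    finally show ?thesis using False by (simp add: excess_def)
  qed
qed

text \<open>Pulling out all \<open>walks_neq m (l i)\<close> leaves, for each color
  \<open>b\<close>, the ratios of the paths leading to \<open>b\<close>, that is,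
  \<open>1 + excess\<close> of its block. The ones add up to \<open>card B\<close>.\<close>

lemma sum_prod_walks:
  fixes \<tau> :: "nat \<Rightarrow> 'b"
  assumes "3 \<le> m" and "finite K" and "\<And>i. i \<in> K \<Longrightarrow> 1 \<le> l i"
  shows "real (\<Sum>b\<in>B. \<Prod>i\<in>K. if b = \<tau> i then walks_eq m (l i) else walks_neq m (l i)) =
    (\<Prod>i\<in>K. real (walks_neq m (l i))) * (real (card B) + (\<Sum>b\<in>B. excess m l {i\<in>K. b = \<tau> i}))"
proof -
  have "real (\<Prod>i\<in>K. if b = \<tau> i then walks_eq m (l i) else walks_neq m (l i)) =
      (\<Prod>i\<in>K. real (walks_neq m (l i))) * (1 + excess m l {i\<in>K. b = \<tau> i})" for b
  proof -
    have "real (\<Prod>i\<in>K. if b = \<tau> i then walks_eq m (l i) else walks_neq m (l i)) =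
      (\<Prod>i\<in>K. real (walks_neq m (l i)) *
        (if b = \<tau> i then real (walks_eq m (l i)) / real (walks_neq m (l i)) else 1))"
      unfolding of_nat_prod
    proof (intro prod.cong refl)
      fix i assume "i \<in> K"
      then have "walks_neq m (l i) \<noteq> 0"
        using walks_neq_pos[of m "l i"] assms by fastforce
      then show "real (if b = \<tau> i then walks_eq m (l i) else walks_neq m (l i)) =
        real (walks_neq m (l i)) *
        (if b = \<tau> i then real (walks_eq m (l i)) / real (walks_neq m (l i)) else 1)"
        by simp
    qed
    also have "\<dots> = (\<Prod>i\<in>K. real (walks_neq m (l i))) * (1 + excess m l {i\<in>K. b = \<tau> i})"
      using assms(2) by (simp add: prod.distrib excess_def prod.inter_filter)
    finally show ?thesis .
  qed
  then show ?thesis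
    by (simp add: sum_distrib_left[symmetric] sum.distrib del: of_nat_prod)
qed

text \<open>The fibers of \<open>\<tau>\<close> are merged one at a time into the one containing
  \<open>p\<close>. The growing block has the sign of \<open>(-1) ^ l p\<close>, while the fiber
  added consists of paths of the other parity and has the opposite sign or excess 0. The cross term
  is thus never positive, and no merge increases the sum.\<close>

lemma sum_excess_ge:
  fixes \<tau> :: "nat \<Rightarrow> 'b"
  assumes m: "2 * k + 3 \<le> m" and K: "finite K" "card K \<le> k" "p \<in> K" and B: "finite B" "\<tau> ` K \<subseteq> B"
    and "1 \<le> l p" and le: "\<And>i. i \<in> K \<Longrightarrow> l p \<le> l i"
    and par: "\<And>i. i \<in> K - {p} \<Longrightarrow> even (l i) \<noteq> even (l p)"
  shows "excess m l K \<le> (\<Sum>b\<in>B. excess m l {i\<in>K. b = \<tau> i})"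
proof -
  let ?S = "\<lambda>D. {i\<in>K. \<tau> i \<in> D}"
  \<comment> \<open>\<open>D\<close> collects the colors whose fibers have been merged so far; the
    claim is used with \<open>D = B - {\<tau> p}\<close>.\<close>
  have "excess m l (?S (insert (\<tau> p) D)) \<le> (\<Sum>b\<in>insert (\<tau> p) D. excess m l {i\<in>K. b = \<tau> i})"
    if "finite D" "\<tau> p \<notin> D" for D
    using that
  proof (induction D rule: finite_induct)
    case empty
    have "?S {\<tau> p} = {i\<in>K. \<tau> p = \<tau> i}" by auto
    then show ?case by simp
  next
    case (insert d D)
    let ?X = "?S (insert (\<tau> p) D)" and ?Y = "{i\<in>K. d = \<tau> i}"
    have "0 < (-1) ^ l p * excess m l ?X"
    proof (rule excess_dominant_sign[where k = k])
      show "card ?X \<le> k"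
        using card_mono[of K ?X] K by fastforce
    qed (use K m assms(7) le in auto)
    moreover have "0 \<le> (-1) ^ Suc (l p) * excess m l ?Y"
    proof (rule excess_sign)
      fix i assume "i \<in> ?Y"
      then have "i \<in> K - {p}" using insert by auto
      then show "1 \<le> l i" "even (l i) \<longleftrightarrow> even (Suc (l p))"
        using le[of i] par[of i] assms(7) by auto
    qed (use m in simp)
    ultimately have "excess m l ?X * excess m l ?Y \<le> 0"
      by (cases "even (l p)") (auto simp: mult_le_0_iff)
    moreover have "?S (insert (\<tau> p) (insert d D)) = ?X \<union> ?Y" "?X \<inter> ?Y = {}"
      using insert by auto
    ultimately have "excess m l (?S (insert (\<tau> p) (insert d D))) \<le> excess m l ?X + excess m l ?Y"
      using excess_Un[of ?X ?Y m l] K by simp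
    also have "\<dots> \<le> (\<Sum>b\<in>insert (\<tau> p) D. excess m l {i\<in>K. b = \<tau> i}) + excess m l ?Y"
      using insert by simp
    also have "\<dots> = (\<Sum>b\<in>insert (\<tau> p) (insert d D). excess m l {i\<in>K. b = \<tau> i})"
      using insert by (subst insert_commute) (subst sum.insert, auto)
    finally show ?case .
  qed
  from this[of "B - {\<tau> p}"]
  have "excess m l (?S (insert (\<tau> p) B)) \<le> (\<Sum>b\<in>insert (\<tau> p) B. excess m l {i\<in>K. b = \<tau> i})"
    using B by simp
  moreover have "insert (\<tau> p) B = B"
    using B K(3) by auto
  ultimately have "excess m l (?S B) \<le> (\<Sum>b\<in>B. excess m l {i\<in>K. b = \<tau> i})"
    by (simp only:)
  moreover have "?S B = K" using B by auto
  ultimately show ?thesis by simp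
qed

section \<open>Block sums for the identity matchings and for one deviating path\<close>

lemma sum_excess_const:
  assumes "finite B" "t \<in> B"
  shows "(\<Sum>b\<in>B. excess m l {i\<in>K. b = t}) = excess m l K"
proof -
  have "(\<Sum>b\<in>B. excess m l {i\<in>K. b = t}) = (\<Sum>b\<in>B. if b = t then excess m l K else 0)"
    by (intro sum.cong) auto
  then show ?thesis using assms by simp
qed

lemma sum_excess_twisted:
  assumes "finite B" "t \<in> B" "t' \<in> B" "t \<noteq> t'" "j \<in> K"
  shows "(\<Sum>b\<in>B. excess m l {i\<in>K. b = (if i = j then t' else t)}) =
    excess m l (K - {j}) + excess m l {j}"
proof -
  have "(\<Sum>b\<in>B. excess m l {i\<in>K. b = (if i = j then t' else t)}) =
      (\<Sum>b\<in>B. (if b = t then excess m l (K - {j}) else 0) + (if b = t' then excess m l {j} else 0))"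
  proof (intro sum.cong refl)
    fix b
    have "{i\<in>K. b = (if i = j then t' else t)} =
        (if b = t then K - {j} else if b = t' then {j} else {})"
      using assms(4,5) by auto
    then show "excess m l {i\<in>K. b = (if i = j then t' else t)} =
        (if b = t then excess m l (K - {j}) else 0) + (if b = t' then excess m l {j} else 0)"
      using assms(4) by simp
  qed
  then show ?thesis using assms by (simp add: sum.distrib)
qed

section \<open>Covers\<close>

text \<open>An independent set meets each clique \<open>L u\<close> at most once, so one of size
  \<open>card (pverts G)\<close> picks exactly one vertex from each and is the image of a unique
  choice function. As \<open>H\<close> has cross edges only over edges of \<open>G\<close>,
  independence need only be checked there.\<close>

lemma card_cover_colorings:
  assumes G: "pair_graph G" and C: "is_cover G L H"
  shows "card (cover_colorings G H) =
    card {c \<in> Pi\<^sub>E (pverts G) L. \<forall>(u, v)\<in>parcs G. (c u, c v) \<notin> parcs H}"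
proof -
  let ?V = "pverts G"
  let ?T = "{c \<in> Pi\<^sub>E ?V L. \<forall>(u, v)\<in>parcs G. (c u, c v) \<notin> parcs H}"
  have H: "finite (pverts H)" "irrefl (parcs H)" and V: "finite ?V"
    and part: "partition_on (pverts H) (L ` ?V)" and injL: "inj_on L ?V"
    and clique: "\<And>u. u \<in> ?V \<Longrightarrow> is_clique H (L u)"
    and edge: "\<And>u v. u \<in> ?V \<Longrightarrow> v \<in> ?V \<Longrightarrow> edges_between H (L u) (L v) \<noteq> {} \<Longrightarrow>
      u = v \<or> (u, v) \<in> parcs G"
    using G C by (auto simp: is_cover_def pair_graph_iff)
  have cover: "pverts H = (\<Union>u\<in>?V. L u)"
    using part by (auto simp: partition_on_def)
  have disj: "u = v" if "x \<in> L u" "x \<in> L v" "u \<in> ?V" "v \<in> ?V" for x u v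
    using part injL that unfolding partition_on_def disjoint_def inj_on_def
    by (metis IntI empty_iff imageI)
  have inj_c: "inj_on c ?V" if "c \<in> Pi\<^sub>E ?V L" for c
    using disj that by (intro inj_onI) (metis PiE_mem)
  have "bij_betw (\<lambda>c. c ` ?V) ?T (cover_colorings G H)"
    unfolding bij_betw_def
  proof (intro conjI equalityI)
    show "inj_on (\<lambda>c. c ` ?V) ?T"
    proof (rule inj_onI)
      fix c d assume cd: "c \<in> ?T" "d \<in> ?T" "c ` ?V = d ` ?V"
      show "c = d"
      proof (rule PiE_ext)
        show "c \<in> Pi\<^sub>E ?V L" "d \<in> Pi\<^sub>E ?V L" using cd by auto
        fix u assume u: "u \<in> ?V"
        then obtain v where v: "v \<in> ?V" "c u = d v"
          using cd(3) by (metis imageE imageI)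
        moreover have "c u \<in> L u"
          using cd(1) u by auto
        moreover have "d v \<in> L v"
          using cd(2) v(1) by auto
        ultimately show "c u = d u"
          using disj[of "c u" u v] u by auto
      qed
    qed
    show "(\<lambda>c. c ` ?V) ` ?T \<subseteq> cover_colorings G H"
    proof (rule image_subsetI)
      fix c assume c: "c \<in> ?T"
      have "(c u, c v) \<notin> parcs H" if uv: "u \<in> ?V" "v \<in> ?V" for u v
      proof
        assume a: "(c u, c v) \<in> parcs H"
        then have "edges_between H (L u) (L v) \<noteq> {}"
          using c uv by (fastforce simp: edges_between_def)
        then have "u = v \<or> (u, v) \<in> parcs G"
          using edge uv by blast
        then show False
          using a c H(2) by (auto simp: irrefl_def)
      qed
      moreover have "c ` ?V \<subseteq> pverts H"
        using c by (auto simp: cover)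
      ultimately show "c ` ?V \<in> cover_colorings G H"
        using c by (auto simp: cover_colorings_def is_independent_def card_image[OF inj_c])
    qed
    show "cover_colorings G H \<subseteq> (\<lambda>c. c ` ?V) ` ?T"
    proof
      fix I assume "I \<in> cover_colorings G H"
      then have I: "I \<subseteq> pverts H" "\<And>x y. x \<in> I \<Longrightarrow> y \<in> I \<Longrightarrow> (x, y) \<notin> parcs H"
        and card_I: "card I = card ?V"
        by (auto simp: cover_colorings_def is_independent_def)
      have "\<forall>x\<in>I. \<exists>u\<in>?V. x \<in> L u"
        using I(1) by (auto simp: cover)
      \<comment> \<open>\<open>own x\<close> is the vertex of \<open>G\<close> whose clique contains
        \<open>x\<close>. It is injective on \<open>I\<close> by the clique property, hence onto by
        cardinality.\<close>
      then obtain own where own: "\<And>x. x \<in> I \<Longrightarrow> own x \<in> ?V \<and> x \<in> L (own x)"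
        by metis
      have "inj_on own I"
      proof (rule inj_onI)
        fix x y assume xy: "x \<in> I" "y \<in> I" "own x = own y"
        then have "x \<in> L (own x)" "y \<in> L (own x)" "own x \<in> ?V"
          using own[of x] own[of y] by auto
        then show "x = y"
          using clique[of "own x"] I(2)[of x y] xy by (auto simp: is_clique_def)
      qed
      then have "card (own ` I) = card ?V"
        using card_I by (simp add: card_image)
      moreover have "own ` I \<subseteq> ?V"
        using own by auto
      ultimately have "own ` I = ?V"
        using V card_subset_eq by blast
      then have "\<forall>u\<in>?V. \<exists>x\<in>I. x \<in> L u"
        using own by (metis imageE)
      then obtain c0 where c0: "\<And>u. u \<in> ?V \<Longrightarrow> c0 u \<in> I \<and> c0 u \<in> L u"
        by metis
      define c where "c = restrict c0 ?V"
      have c: "c \<in> Pi\<^sub>E ?V L" "c ` ?V \<subseteq> I"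
        using c0 by (auto simp: c_def)
      moreover have "finite I"
        using I(1) H(1) finite_subset by blast
      ultimately have "c ` ?V = I"
        using card_I inj_c[OF c(1)] by (intro card_subset_eq) (auto simp: card_image)
      moreover have "c \<in> ?T"
      proof -
        have "(c u, c v) \<notin> parcs H" if "(u, v) \<in> parcs G" for u v
        proof -
          have "u \<in> ?V" "v \<in> ?V" using G that by (auto simp: pair_graph_iff)
          then show ?thesis using I(2) c(2) by blast
        qed
        then show ?thesis using c by auto
      qed
      ultimately show "I \<in> (\<lambda>c. c ` ?V) ` ?T" by blast
    qed
  qed
  then show ?thesis
    by (simp add: bij_betw_same_card)
qed

text \<open>On its domain \<open>D\<close> the relation is an injection \<open>g\<close>. What
  remains on the two sides has equal size, so any bijection \<open>h\<close> between the remainders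
  completes it.\<close>

lemma partial_matching_extends:
  assumes "finite A" "finite B" "card A = card B"
    and fun_R: "\<And>x y y'. x \<in> A \<Longrightarrow> y \<in> B \<Longrightarrow> y' \<in> B \<Longrightarrow> R x y \<Longrightarrow> R x y' \<Longrightarrow> y = y'"
    and inj_R: "\<And>x x' y. x \<in> A \<Longrightarrow> x' \<in> A \<Longrightarrow> y \<in> B \<Longrightarrow> R x y \<Longrightarrow> R x' y \<Longrightarrow> x = x'"
  obtains f where "bij_betw f A B" "\<And>x y. x \<in> A \<Longrightarrow> y \<in> B \<Longrightarrow> R x y \<Longrightarrow> y = f x"
proof -
  define D where "D = {x \<in> A. \<exists>y\<in>B. R x y}"
  have "\<forall>x\<in>D. \<exists>y\<in>B. R x y"
    by (auto simp: D_def)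
  then obtain g where g: "\<And>x. x \<in> D \<Longrightarrow> g x \<in> B \<and> R x (g x)"
    by metis
  have D: "D \<subseteq> A" "g ` D \<subseteq> B"
    using g by (auto simp: D_def)
  have "inj_on g D"
    using g inj_R D(1) by (intro inj_onI) (metis subsetD)
  then have bij_g: "bij_betw g D (g ` D)"
    by (simp add: bij_betw_def)
  have "card (A - D) = card (B - g ` D)"
    using D assms(1-3) \<open>inj_on g D\<close> finite_subset[OF D(1)]
    by (simp add: card_Diff_subset card_image)
  then obtain h where h: "bij_betw h (A - D) (B - g ` D)"
    using assms(1,2) finite_same_card_bij by blast
  define f where "f x = (if x \<in> D then g x else h x)" for x
  have "bij_betw f D (g ` D)"
    using bij_g by (subst bij_betw_cong[of _ _ g]) (auto simp: f_def)
  moreover have "bij_betw f (A - D) (B - g ` D)"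
    using h by (subst bij_betw_cong[of _ _ h]) (auto simp: f_def)
  ultimately have "bij_betw f (D \<union> (A - D)) (g ` D \<union> (B - g ` D))"
    by (rule bij_betw_combine) auto
  then have "bij_betw f A B"
    using D by (simp add: Un_absorb1)
  moreover have "y = f x" if "x \<in> A" "y \<in> B" "R x y" for x y
  proof -
    have "x \<in> D" using that by (auto simp: D_def)
    then show ?thesis using that fun_R[of x y "g x"] g by (auto simp: f_def)
  qed
  ultimately show thesis
    by (rule that)
qed

lemma parcs_theta_graph:
  "(u, v) \<in> parcs (theta_graph k l) \<longleftrightarrow> (\<exists>i j. i \<in> {1..k} \<and> j < l i \<and>
    ((u, v) = (theta_path l i j, theta_path l i (Suc j)) \<or>
     (u, v) = (theta_path l i (Suc j), theta_path l i j)))"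
  by (simp only: theta_graph_def pair_pre_digraph.simps) blast

text \<open>The reduction to perfect matchings: completing every matching to a bijection only adds
  constraints, so no coloring is gained.\<close>

lemma theta_colorings_le_cover_colorings:
  assumes C: "is_fold_cover m (theta_graph k l) L H"
  obtains F where
    "\<And>i j. i \<in> {1..k} \<Longrightarrow> j < l i \<Longrightarrow>
      bij_betw (F i j) (L (theta_path l i j)) (L (theta_path l i (Suc j)))"
    "card (theta_colorings k l L F) \<le> card (cover_colorings (theta_graph k l) H)"
proof -
  let ?G = "theta_graph k l"
  have cov: "is_cover ?G L H" and m: "\<And>u. u \<in> pverts ?G \<Longrightarrow> card (L u) = m"
    using C by (auto simp: is_fold_cover_def)
  have H: "finite (pverts H)" "sym (parcs H)"
    and part: "partition_on (pverts H) (L ` pverts ?G)"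
    and match: "\<And>u v. (u, v) \<in> parcs ?G \<Longrightarrow> is_matching (edges_between H (L u) (L v))"
    using cov by (auto simp: is_cover_def pair_graph_iff)
  have fin: "finite (L u)" if "u \<in> pverts ?G" for u
    using part H(1) that by (auto simp: partition_on_def intro: finite_subset)
  have ex: "\<exists>f. bij_betw f (L u) (L v) \<and> (\<forall>x\<in>L u. \<forall>y\<in>L v. (x, y) \<in> parcs H \<longrightarrow> y = f x)"
    if uv: "(u, v) \<in> parcs ?G" for u v
  proof -
    have V: "u \<in> pverts ?G" "v \<in> pverts ?G"
      using uv pair_graph_theta_graph[of k l] by (auto simp: pair_graph_iff)
    \<comment> \<open>Two edges of a matching that share a vertex coincide; this makes the relation
      functional and injective.\<close>
    have meet: "{x, y} = {x', y'}" if "x \<in> L u" "y \<in> L v" "x' \<in> L u" "y' \<in> L v"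
      "(x, y) \<in> parcs H" "(x', y') \<in> parcs H" "{x, y} \<inter> {x', y'} \<noteq> {}" for x y x' y'
    proof -
      have "{x, y} \<in> edges_between H (L u) (L v)" "{x', y'} \<in> edges_between H (L u) (L v)"
        using that by (auto simp: edges_between_def)
      then show ?thesis
        using match[OF uv] that(7) unfolding is_matching_def pairwise_def disjnt_def by metis
    qed
    obtain f where "bij_betw f (L u) (L v)"
      "\<And>x y. x \<in> L u \<Longrightarrow> y \<in> L v \<Longrightarrow> (x, y) \<in> parcs H \<Longrightarrow> y = f x"
    proof (rule partial_matching_extends[of "L u" "L v" "\<lambda>x y. (x, y) \<in> parcs H"])
      show "y = y'" if "x \<in> L u" "y \<in> L v" "y' \<in> L v" "(x, y) \<in> parcs H" "(x, y') \<in> parcs H"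
        for x y y'
        using meet[of x y x y'] that by (auto simp: doubleton_eq_iff)
      show "x = x'" if "x \<in> L u" "x' \<in> L u" "y \<in> L v" "(x, y) \<in> parcs H" "(x', y) \<in> parcs H"
        for x x' y
        using meet[of x y x' y] that by (auto simp: doubleton_eq_iff)
    qed (use fin m V in auto)
    then show ?thesis by blast
  qed
  have arc: "(theta_path l i j, theta_path l i (Suc j)) \<in> parcs ?G" if "i \<in> {1..k}" "j < l i" for i j
    using that parcs_theta_graph by blast
  have "\<forall>i j. \<exists>f. i \<in> {1..k} \<and> j < l i \<longrightarrow>
      bij_betw f (L (theta_path l i j)) (L (theta_path l i (Suc j))) \<and>
      (\<forall>x\<in>L (theta_path l i j). \<forall>y\<in>L (theta_path l i (Suc j)). (x, y) \<in> parcs H \<longrightarrow> y = f x)"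
    using ex arc by metis
  then obtain F where F: "\<And>i j. i \<in> {1..k} \<and> j < l i \<longrightarrow>
      bij_betw (F i j) (L (theta_path l i j)) (L (theta_path l i (Suc j))) \<and>
      (\<forall>x\<in>L (theta_path l i j). \<forall>y\<in>L (theta_path l i (Suc j)). (x, y) \<in> parcs H \<longrightarrow> y = F i j x)"
    by metis
  have "theta_colorings k l L F \<subseteq>
      {c \<in> Pi\<^sub>E (pverts ?G) L. \<forall>(u, v)\<in>parcs ?G. (c u, c v) \<notin> parcs H}" (is "_ \<subseteq> ?T")
  proof
    fix c assume c: "c \<in> theta_colorings k l L F"
    have step: "(c (theta_path l i j), c (theta_path l i (Suc j))) \<notin> parcs H"
      if ij: "i \<in> {1..k}" "j < l i" for i j
    proof -
      have "c (theta_path l i j) \<in> L (theta_path l i j)"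
        "c (theta_path l i (Suc j)) \<in> L (theta_path l i (Suc j))"
        using c ij theta_path_in[of i k j l] theta_path_in[of i k "Suc j" l]
        by (auto simp: theta_colorings_def)
      moreover have "c (theta_path l i (Suc j)) \<noteq> F i j (c (theta_path l i j))"
        using c ij by (auto simp: theta_colorings_def)
      ultimately show ?thesis
        using F[of i j] ij by blast
    qed
    have "(c u, c v) \<notin> parcs H" if "(u, v) \<in> parcs ?G" for u v
      using that step symD[OF H(2)] unfolding parcs_theta_graph by blast
    then show "c \<in> ?T"
      using c by (auto simp: theta_colorings_def)
  qed
  moreover have "finite ?T"
    by (rule finite_subset[OF _ finite_PiE[of "pverts ?G" L]])
      (auto simp: fin finite_pverts_theta_graph)
  ultimately have "card (theta_colorings k l L F) \<le> card (cover_colorings ?G H)"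
    unfolding card_cover_colorings[OF pair_graph_theta_graph cov] by (intro card_mono)
  with F show thesis
    by (intro that) auto
qed

section \<open>Proper colorings and covers twisted along one path\<close>

lemma chromatic_polynomial_theta:
  "chromatic_polynomial (theta_graph k l) m =
    card (theta_colorings k l (\<lambda>_. {1..m}) (\<lambda>_ _ x. x))"
proof -
  have "proper_colorings (theta_graph k l) m = theta_colorings k l (\<lambda>_. {1..m}) (\<lambda>_ _ x. x)"
    unfolding proper_colorings_def theta_colorings_def
  proof (intro Collect_cong conj_cong refl iffI ballI allI impI)
    fix c :: "theta_vertex \<Rightarrow> nat" and i j
    assume c: "\<forall>(u, v)\<in>parcs (theta_graph k l). c u \<noteq> c v" and "i \<in> {1..k}" "j < l i"
    then have "(theta_path l i (Suc j), theta_path l i j) \<in> parcs (theta_graph k l)"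
      using parcs_theta_graph by blast
    with c show "c (theta_path l i (Suc j)) \<noteq> c (theta_path l i j)"
      by blast
  next
    fix c :: "theta_vertex \<Rightarrow> nat" and e
    assume c: "\<forall>i\<in>{1..k}. \<forall>j<l i. c (theta_path l i (Suc j)) \<noteq> c (theta_path l i j)"
      and e: "e \<in> parcs (theta_graph k l)"
    obtain u v where uv: "e = (u, v)"
      by (cases e)
    with e obtain i j where "i \<in> {1..k}" "j < l i"
      "(u, v) = (theta_path l i j, theta_path l i (Suc j)) \<or>
       (u, v) = (theta_path l i (Suc j), theta_path l i j)"
      using parcs_theta_graph by blast
    with c have "c u \<noteq> c v"
      by (metis prod.inject)
    with uv show "case e of (u, v) \<Rightarrow> c u \<noteq> c v"
      by simp
  qed
  then show ?thesis
    by (simp add: chromatic_polynomial_def)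
qed

text \<open>Concentrating the twist on a single edge makes the map induced along path
  \<open>p\<close> equal to \<open>s\<close>, while all other paths induce the identity.\<close>

definition last_edge_twist ::
  "(nat \<Rightarrow> nat) \<Rightarrow> nat \<Rightarrow> (nat \<Rightarrow> nat) \<Rightarrow> nat \<Rightarrow> nat \<Rightarrow> nat \<Rightarrow> nat" where
  "last_edge_twist l p s i j x = (if i = p \<and> Suc j = l p then s x else x)"

lemma path_map_ident:
  assumes "\<And>j x. j < n \<Longrightarrow> f j x = x"
  shows "path_map f n a = a"
  using assms by (induction n) auto

lemma path_map_last_edge_twist:
  assumes "1 \<le> l p"
  shows "path_map (last_edge_twist l p s i) (l i) a = (if i = p then s a else a)"
proof (cases "i = p")
  case True
  then obtain n where "l i = Suc n"
    using assms by (cases "l p") auto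
  moreover from this have "path_map (last_edge_twist l p s i) n a = a"
    using True by (intro path_map_ident) (auto simp: last_edge_twist_def)
  ultimately show ?thesis
    using True by (simp add: last_edge_twist_def)
next
  case False
  then show ?thesis
    by (simp add: path_map_ident last_edge_twist_def)
qed

text \<open>Realizes the twisted matchings by an actual cover on pairs of a vertex and a color. As
  \<open>2 \<le> l p\<close>, the last edge of path \<open>p\<close> starts at the inner vertex
  \<open>?w\<close>, which lies on no other path, so the twisted edge is determined by its end
  vertices.\<close>

lemma dp_color_function_le_twisted:
  assumes m: "1 \<le> m" and s: "bij_betw s {1..m} {1..m}" and p: "p \<in> {1..k}" "2 \<le> l p"
  shows "dp_color_function (theta_graph k l) m \<le>
    card (theta_colorings k l (\<lambda>_. {1..m}) (last_edge_twist l p s))"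
proof -
  let ?G = "theta_graph k l" and ?w = "Inner p (l p - 1)"
  let ?V = "pverts ?G"
  \<comment> \<open>\<open>R\<close> is defined for both directions of an edge; the second clause
    reverses the twist, which makes the arcs of \<open>H\<close> symmetric.\<close>
  define R where "R u v x y \<longleftrightarrow> (if u = ?w \<and> v = End2 then y = s x
    else if u = End2 \<and> v = ?w then x = s y else x = y)" for u v x y
  define L :: "theta_vertex \<Rightarrow> (theta_vertex \<times> nat) set" where "L u = {u} \<times> {1..m}" for u
  define H where "H = \<lparr> pverts = ?V \<times> {1..m},
    parcs = {((u, x), (v, y)). u \<in> ?V \<and> v \<in> ?V \<and> x \<in> {1..m} \<and> y \<in> {1..m} \<and>
      (u = v \<and> x \<noteq> y \<or> (u, v) \<in> parcs ?G \<and> R u v x y)} \<rparr>"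
  have G: "sym (parcs ?G)" "irrefl (parcs ?G)" "parcs ?G \<subseteq> ?V \<times> ?V"
    using pair_graph_theta_graph[of k l] by (auto simp: pair_graph_iff)
  have R_sym: "R u v x y \<longleftrightarrow> R v u y x" for u v x y
    by (auto simp: R_def)
  have R_fun: "y = y'" if "R u v x y" "R u v x y'" "x \<in> {1..m}" "y \<in> {1..m}" "y' \<in> {1..m}" for u v x y y'
  proof -
    have "y = s x \<and> y' = s x \<or> s y = s y' \<or> y = x \<and> y' = x"
      using that(1,2) unfolding R_def by metis
    then show ?thesis
      using inj_onD[OF bij_betw_imp_inj_on[OF s] _ that(4,5)] by blast
  qed
  have R_inj: "x = x'" if "R u v x y" "R u v x' y" "x \<in> {1..m}" "x' \<in> {1..m}" "y \<in> {1..m}" for u v x x' y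
    using R_fun[of v u y x x'] R_sym that by blast
  have pg: "pair_graph H"
    unfolding pair_graph_iff
  proof (intro conjI)
    show "finite (pverts H)" "parcs H \<subseteq> pverts H \<times> pverts H"
      by (auto simp: H_def finite_pverts_theta_graph)
    show "sym (parcs H)"
      using symD[OF G(1)] R_sym by (auto simp: H_def sym_def)
    show "irrefl (parcs H)"
      using G(2) by (auto simp: H_def irrefl_def)
  qed
  have in_L: "(u, 1) \<in> L v \<longleftrightarrow> u = v" for u v
    using m by (auto simp: L_def)
  have part: "partition_on (pverts H) (L ` ?V)"
  proof (rule partition_onI)
    show "{} \<notin> L ` ?V"
      using in_L by (metis empty_iff imageE)
  qed (auto simp: L_def H_def disjnt_def)
  have inj: "inj_on L ?V"
    using in_L by (metis inj_onI)
  have cliq: "\<forall>u\<in>?V. is_clique H (L u)"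
    by (auto simp: is_clique_def L_def H_def)
  have edges: "\<forall>u\<in>?V. \<forall>v\<in>?V. edges_between H (L u) (L v) \<noteq> {} \<longrightarrow> u = v \<or> (u, v) \<in> parcs ?G"
    by (auto simp: edges_between_def L_def H_def)
  have matching: "is_matching (edges_between H (L u) (L v))" if uv: "(u, v) \<in> parcs ?G" for u v
    unfolding is_matching_def
  proof (rule pairwiseI)
    fix d e assume de: "d \<in> edges_between H (L u) (L v)" "e \<in> edges_between H (L u) (L v)" "d \<noteq> e"
    have "u \<noteq> v"
      using uv G(2) by (auto simp: irrefl_def)
    obtain x y where xy: "d = {(u, x), (v, y)}" "R u v x y" "x \<in> {1..m}" "y \<in> {1..m}"
      using de(1) \<open>u \<noteq> v\<close> by (auto simp: edges_between_def L_def H_def)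
    obtain x' y' where xy': "e = {(u, x'), (v, y')}" "R u v x' y'" "x' \<in> {1..m}" "y' \<in> {1..m}"
      using de(2) \<open>u \<noteq> v\<close> by (auto simp: edges_between_def L_def H_def)
    have "x \<noteq> x' \<and> y \<noteq> y'"
      using R_fun[of u v x y y'] R_inj[of u v x y x'] xy xy' de(3) by blast
    then show "disjnt d e"
      using \<open>u \<noteq> v\<close> by (auto simp: xy xy' disjnt_def)
  qed
  have cov: "is_cover ?G L H"
    unfolding is_cover_def using pg part inj cliq edges matching by (auto simp: split_beta)
  then have "is_fold_cover m ?G L H"
    by (simp add: is_fold_cover_def L_def)
  then have "dp_color_function ?G m \<le> card (cover_colorings ?G H)"
    using dp_color_function_le pair_graph_theta_graph by blast
  also have "\<dots> = card {c \<in> Pi\<^sub>E ?V L. \<forall>(u, v)\<in>parcs ?G. (c u, c v) \<notin> parcs H}"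
    (is "_ = card ?T")
    by (rule card_cover_colorings[OF pair_graph_theta_graph cov])
  also have "\<dots> \<le> card ((\<lambda>c. \<lambda>u\<in>?V. (u, c u)) `
      theta_colorings k l (\<lambda>_. {1..m}) (last_edge_twist l p s))"
  proof (intro card_mono finite_imageI finite_theta_colorings subsetI)
    fix c assume c: "c \<in> ?T"
    \<comment> \<open>A transversal has \<open>c u\<close> of the form \<open>(u, d u)\<close>; only
      the color component carries information.\<close>
    define d where "d = (\<lambda>u\<in>?V. snd (c u))"
    have cd: "c u = (u, d u)" "d u \<in> {1..m}" if "u \<in> ?V" for u
    proof -
      have "c u \<in> L u" using c that by auto
      then show "c u = (u, d u)" "d u \<in> {1..m}" using that by (auto simp: d_def L_def)
    qed
    have "d (theta_path l i (Suc j)) \<noteq> last_edge_twist l p s i j (d (theta_path l i j))"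
      if ij: "i \<in> {1..k}" "j < l i" for i j
    proof
      let ?u = "theta_path l i j" and ?v = "theta_path l i (Suc j)"
      assume eq: "d ?v = last_edge_twist l p s i j (d ?u)"
      have V: "?u \<in> ?V" "?v \<in> ?V"
        using ij theta_path_in[of i k j l] theta_path_in[of i k "Suc j" l] by auto
      have arc: "(?u, ?v) \<in> parcs ?G"
        using ij parcs_theta_graph by blast
      have "R ?u ?v (d ?u) (d ?v)"
        using eq ij p by (auto simp: R_def last_edge_twist_def theta_path_def split: if_splits)
      then have "(c ?u, c ?v) \<in> parcs H"
        using cd[OF V(1)] cd[OF V(2)] V arc by (simp add: H_def)
      then show False
        using c arc by auto
    qed
    moreover have "d \<in> ?V \<rightarrow>\<^sub>E {1..m}"
      using cd by (auto simp: d_def)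
    ultimately have "d \<in> theta_colorings k l (\<lambda>_. {1..m}) (last_edge_twist l p s)"
      by (auto simp: theta_colorings_def)
    moreover have "c = (\<lambda>u\<in>?V. (u, d u))"
      using c cd by (auto simp: fun_eq_iff PiE_iff extensional_def)
    ultimately show "c \<in> (\<lambda>c. \<lambda>u\<in>?V. (u, c u)) `
        theta_colorings k l (\<lambda>_. {1..m}) (last_edge_twist l p s)"
      by blast
  qed simp
  also have "\<dots> \<le> card (theta_colorings k l (\<lambda>_. {1..m}) (last_edge_twist l p s))"
    by (intro card_image_le finite_theta_colorings) simp
  finally show ?thesis .
qed

section \<open>The DP color function of theta graphs\<close>

lemma real_card_theta_colorings:
  assumes "3 \<le> m" and "\<And>i. i \<in> {1..k} \<Longrightarrow> 1 \<le> l i"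
    and L: "\<And>u. u \<in> pverts (theta_graph k l) \<Longrightarrow> finite (L u)"
      "\<And>u. u \<in> pverts (theta_graph k l) \<Longrightarrow> card (L u) = m"
    and F: "\<And>i j. i \<in> {1..k} \<Longrightarrow> j < l i \<Longrightarrow>
      bij_betw (F i j) (L (theta_path l i j)) (L (theta_path l i (Suc j)))"
  shows "real (card (theta_colorings k l L F)) = (\<Sum>a\<in>L End1.
    (\<Prod>i\<in>{1..k}. real (walks_neq m (l i))) *
    (real m + (\<Sum>b\<in>L End2. excess m l {i\<in>{1..k}. b = path_map (F i) (l i) a})))"
proof -
  have "card (L End2) = m"
    by (rule L(2)) (simp add: pverts_theta_graph)
  moreover have "card (theta_colorings k l L F) = (\<Sum>a\<in>L End1. \<Sum>b\<in>L End2. \<Prod>i\<in>{1..k}.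
      if b = path_map (F i) (l i) a then walks_eq m (l i) else walks_neq m (l i))"
    by (rule card_theta_colorings) (use assms in auto)
  ultimately show ?thesis
    using sum_prod_walks[OF assms(1) finite_atLeastAtMost assms(2),
        where B = "L End2" and \<tau> = "\<lambda>i. path_map (F i) (l i) a" for a]
    by (simp only: of_nat_sum)
qed

text \<open>This is the twist for the strict inequality: for \<open>2 \<le> m\<close> the shift has
  no fixed point, so a path twisted by it never agrees with the untwisted paths.\<close>

lemma bij_betw_cyclic_shift:
  assumes "1 \<le> m"
  shows "bij_betw (\<lambda>x. if x = m then 1 else Suc x) {1..m} {1..m}"
  by (rule bij_betw_byWitness[where f' = "\<lambda>x. if x = 1 then m else x - 1"]) (use assms in auto)

theorem theorem1p4:
  fixes k :: nat and l :: "nat \<Rightarrow> nat"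
  assumes "2 \<le> k"
    and "\<forall>i\<in>{1..k}. 1 \<le> l i"
    and "mono_on {2..k} l"
    and "max (l 1) 2 \<le> l 2"
  shows
    "((\<exists>j\<in>{2..k}. even (l 1) \<longleftrightarrow> even (l j)) \<longrightarrow>
        (\<exists>N. \<forall>m\<ge>N. dp_color_function (theta_graph k l) m < chromatic_polynomial (theta_graph k l) m)) \<and>
     ((\<forall>j\<in>{2..k}. even (l 1) \<noteq> even (l j)) \<longrightarrow>
        (\<exists>N. \<forall>m\<ge>N. dp_color_function (theta_graph k l) m = chromatic_polynomial (theta_graph k l) m))"
proof -
  let ?G = "theta_graph k l" and ?K = "{1..k}"
  let ?W = "\<lambda>m. \<Prod>i\<in>?K. real (walks_neq m (l i))"
  have l1: "1 \<le> l i" if "i \<in> ?K" for i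
    using assms(2) that by blast
  have ge2: "max (l 1) 2 \<le> l i" if "i \<in> {2..k}" for i
    using mono_onD[OF assms(3), of 2 i] assms(1,4) that by auto
  have l_min: "l 1 \<le> l i" if "i \<in> ?K" for i
    using ge2[of i] that by (cases "i = 1") auto
  have W_pos: "0 < ?W m" if "3 \<le> m" for m
    using walks_neq_pos[OF that l1] by (intro prod_pos) fastforce
  \<comment> \<open>Under identity matchings every path carries \<open>a\<close> to
    \<open>a\<close>, so there is a single block.\<close>
  have chrom: "real (chromatic_polynomial ?G m) = real m * (?W m * (real m + excess m l ?K))"
    if m: "3 \<le> m" for m
  proof -
    have "real (chromatic_polynomial ?G m) = (\<Sum>a\<in>{1..m}. ?W m *
        (real m + (\<Sum>b\<in>{1..m}. excess m l {i\<in>?K. b = path_map (\<lambda>_ x. x) (l i) a})))"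
      unfolding chromatic_polynomial_theta
      by (rule real_card_theta_colorings) (use m l1 in \<open>auto simp: bij_betw_def\<close>)
    also have "\<dots> = (\<Sum>a\<in>{1..m}. ?W m * (real m + excess m l ?K))"
      by (intro sum.cong refl) (simp only: path_map_ident sum_excess_const finite_atLeastAtMost)
    finally show ?thesis by simp
  qed
  \<comment> \<open>Equal parity: twisting path \<open>j\<close> splits the single block into
    \<open>?K - {j}\<close> and \<open>{j}\<close> for every color of \<open>End1\<close>.\<close>
  have "dp_color_function ?G m < chromatic_polynomial ?G m"
    if j: "j \<in> {2..k}" "even (l 1) \<longleftrightarrow> even (l j)" and m: "2 * k + 3 \<le> m" for j m
  proof -
    define s where "s x = (if x = m then 1 else Suc x)" for x
    have m3: "3 \<le> m" using m by simp
    have s: "bij_betw s {1..m} {1..m}"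
      using bij_betw_cyclic_shift[of m] m3 by (simp add: s_def[abs_def])
    have jK: "j \<in> ?K" "2 \<le> l j" "1 \<le> l j"
      using j ge2[of j] by auto
    have "real (card (theta_colorings k l (\<lambda>_. {1..m}) (last_edge_twist l j s))) =
      (\<Sum>a\<in>{1..m}. ?W m * (real m + (\<Sum>b\<in>{1..m}.
        excess m l {i\<in>?K. b = path_map (last_edge_twist l j s i) (l i) a})))"
    proof (rule real_card_theta_colorings)
      show "bij_betw (last_edge_twist l j s i j') {1..m} {1..m}" for i j'
        using s by (cases "i = j \<and> Suc j' = l j")
          (auto simp: last_edge_twist_def[abs_def] bij_betw_def)
    qed (use m3 l1 in auto)
    also have "\<dots> = (\<Sum>a\<in>{1..m}. ?W m * (real m + (excess m l (?K - {j}) + excess m l {j})))"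
    proof (intro sum.cong refl arg_cong2[where f = "(*)"] arg_cong2[where f = "(+)"])
      fix a assume a: "a \<in> {1..m}"
      have "s a \<in> {1..m}" "a \<noteq> s a"
        using a m3 by (auto simp: s_def)
      then show "(\<Sum>b\<in>{1..m}. excess m l {i\<in>?K. b = path_map (last_edge_twist l j s i) (l i) a}) =
          excess m l (?K - {j}) + excess m l {j}"
        using sum_excess_twisted[of "{1..m}" a "s a" j ?K m l] a jK
        by (simp add: path_map_last_edge_twist)
    qed
    also have "\<dots> = real m * (?W m * (real m + (excess m l (?K - {j}) + excess m l {j})))"
      by simp
    also have "\<dots> < real m * (?W m * (real m + excess m l ?K))"
    proof -
      \<comment> \<open>As \<open>2 \<le> j\<close>, path 1 remains in \<open>?K - {j}\<close> and
        dominates it. Both parts have the same nonzero sign, so the cross term lost by splitting is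
        positive.\<close>
      have "0 < (-1) ^ l 1 * excess m l (?K - {j})"
        by (rule excess_dominant_sign[where k = k])
          (use assms(1) m j l1 l_min in \<open>auto simp: card_Diff_subset\<close>)
      moreover have "0 < (-1) ^ l j * excess m l {j}"
        by (rule excess_dominant_sign[where k = k]) (use assms(1) m jK in auto)
      ultimately have "0 < excess m l (?K - {j}) * excess m l {j}"
        using j(2) by (cases "even (l 1)") (auto simp: zero_less_mult_iff)
      moreover have "?K - {j} \<union> {j} = ?K"
        using jK by auto
      ultimately have "excess m l (?K - {j}) + excess m l {j} < excess m l ?K"
        using excess_Un[of "?K - {j}" "{j}" m l] by simp
      then show ?thesis
        using W_pos[OF m3] m3 by simp
    qed
    also have "\<dots> = real (chromatic_polynomial ?G m)"
      using chrom[OF m3] by simp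
    finally have "card (theta_colorings k l (\<lambda>_. {1..m}) (last_edge_twist l j s)) <
        chromatic_polynomial ?G m"
      by simp
    then show ?thesis
      using dp_color_function_le_twisted[of m s j k l] s jK m3 by simp
  qed
  moreover have "dp_color_function ?G m = chromatic_polynomial ?G m"
    if par: "\<forall>j\<in>{2..k}. even (l 1) \<noteq> even (l j)" and m: "2 * k + 3 \<le> m" for m
  proof (rule antisym)
    have m3: "3 \<le> m" using m by simp
    \<comment> \<open>The trivial twist gives the upper bound. Path 2 has length at least 2, as the
      twisted cover requires.\<close>
    have "last_edge_twist l 2 (\<lambda>x. x) = (\<lambda>_ _ x. x)"
      by (auto simp: last_edge_twist_def fun_eq_iff)
    moreover have "bij_betw (\<lambda>x. x) {1..m} {1..m}"
      by (simp add: bij_betw_def)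
    ultimately show "dp_color_function ?G m \<le> chromatic_polynomial ?G m"
      using dp_color_function_le_twisted[of m "\<lambda>x. x" 2 k l] assms(1) ge2[of 2] m3
      by (simp add: chromatic_polynomial_theta)
    \<comment> \<open>For the lower bound, a cover attaining the minimum is completed to perfect
      matchings; merging all blocks into that of path 1 then compares it with the single block, for
      each color \<open>a\<close> of \<open>End1\<close> separately.\<close>
    obtain L :: "theta_vertex \<Rightarrow> nat set" and H where C: "is_fold_cover m ?G L H"
      and dp: "dp_color_function ?G m = card (cover_colorings ?G H)"
      using dp_color_function_attained[OF pair_graph_theta_graph, of m k l] m3 by auto
    obtain F where F: "\<And>i j. i \<in> ?K \<Longrightarrow> j < l i \<Longrightarrow>
        bij_betw (F i j) (L (theta_path l i j)) (L (theta_path l i (Suc j)))"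
      and le: "card (theta_colorings k l L F) \<le> card (cover_colorings ?G H)"
      using theta_colorings_le_cover_colorings[OF C] by blast
    have card_L: "card (L u) = m" if "u \<in> pverts ?G" for u
      using C that by (auto simp: is_fold_cover_def)
    then have fin_L: "finite (L u)" if "u \<in> pverts ?G" for u
      using that m3 by (intro card_ge_0_finite) simp
    have V: "End1 \<in> pverts ?G" "End2 \<in> pverts ?G"
      by (auto simp: pverts_theta_graph)
    have "real m * (?W m * (real m + excess m l ?K)) =
        (\<Sum>a\<in>L End1. ?W m * (real m + excess m l ?K))"
      using card_L[OF V(1)] by simp
    also have "\<dots> \<le> (\<Sum>a\<in>L End1. ?W m *
        (real m + (\<Sum>b\<in>L End2. excess m l {i\<in>?K. b = path_map (F i) (l i) a})))"
    proof (intro sum_mono mult_left_mono add_left_mono)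
      fix a assume a: "a \<in> L End1"
      have "path_map (F i) (l i) a \<in> L End2" if i: "i \<in> ?K" for i
      proof -
        have "path_map (F i) (l i) a \<in> L (theta_path l i (l i))"
          by (rule path_map_in[where L = "\<lambda>j. L (theta_path l i j)"])
            (use F[OF i] a in \<open>auto simp: bij_betw_def theta_path_def\<close>)
        then show ?thesis
          using l1[OF i] by (simp add: theta_path_def)
      qed
      then show "excess m l ?K \<le>
          (\<Sum>b\<in>L End2. excess m l {i\<in>?K. b = path_map (F i) (l i) a})"
        by (intro sum_excess_ge[where k = k and p = 1])
          (use assms(1) m fin_L[OF V(2)] l1 l_min par in auto)
    qed (use W_pos[OF m3] in simp)
    also have "\<dots> = real (card (theta_colorings k l L F))"
      by (rule real_card_theta_colorings[symmetric]) (use m3 l1 fin_L card_L F in auto)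
    finally have "chromatic_polynomial ?G m \<le> card (theta_colorings k l L F)"
      using chrom[OF m3] by simp
    then show "chromatic_polynomial ?G m \<le> dp_color_function ?G m"
      using le dp by simp
  qed
  ultimately show ?thesis
    by meson
qed

end
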